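(* Let $\mu\colon[0,1]\to[0,1]$ be a concave strictly increasing function with $\mu(0)=0$. If $\mu$ does not satisfy the Osgood condition, then for every positive integer $m$ there exist $l\in\mathcal C^\mu([0,1],\mathbb R)$ with $1/2\le l(t)\le 3/2$ for all $t\in[0,1]$, functions $b_1,b_2,c\in C_b^\infty([0,1]\times\mathbb R^2,\mathbb R)$, and a function $u\in C_b^\infty([0,1]\times\mathbb R^2,\mathbb R)$ with $u(1,\cdot)\equiv0$ in $\mathbb R^2$ but $u\not\equiv0$ in $[0,1]\times\mathbb R^2$, such that $$\partial_t u+(-1)^m\big(\partial_{x_1}^{2m}u+l(t)\,\partial_{x_2}^{2m}u\big)+b_1(t,x)\,\partial_{x_1}u+b_2(t,x)\,\partial_{x_2}u+c(t,x)\,u=0\quad\text{in }[0,1]\times\mathbb R^2 .$$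
   Context: A nondecreasing function $\omega\colon[0,1]\to\mathbb R$ with $\omega(0)=0$ satisfies the Osgood condition iff $\int_0^1\frac{1}{\omega(s)}\,ds=+\infty$. For a concave strictly increasing $\mu\colon[0,1]\to[0,1]$ with $\mu(0)=0$, a closed bounded interval $I$ and a Banach space $\mathcal B$, $\mathcal C^\mu(I,\mathcal B)$ denotes the set of functions $f\colon I\to\mathcal B$ such that $$\sup_{t,s\in I,\ 0<|t-s|\le1}\frac{\|f(t)-f(s)\|_{\mathcal B}}{\mu(|t-s|)}<+\infty .$$ $C_b^\infty([0,1]\times\mathbb R^2,\mathbb R)$ denotes the real-valued $C^\infty$ functions on $[0,1]\times\mathbb R^2$ that are bounded together with all their derivatives; $x=(x_1,x_2)\in\mathbb R^2$. *)

theory Defs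
  imports "HOL-Analysis.Analysis"
begin

text \<open>
  The quotient is taken in the extended nonnegative reals, where \<open>1 / 0 = \<infinity>\<close>, so that a modulus
  vanishing near \<open>0\<close> satisfies the condition.  The integral over \<open>[0,1]\<close> sees only the values of
  \<open>\<omega>\<close> there, which are meant to be nonnegative.
\<close>
definition osgood :: "(real \<Rightarrow> real) \<Rightarrow> bool" where
  "osgood \<omega> \<longleftrightarrow> (\<integral>\<^sup>+ s\<in>{0..1}. (1 / ennreal (\<omega> s)) \<partial>lborel) = \<infinity>"

text \<open>
  Functions on \<open>I\<close> are represented by total functions, whose values outside \<open>I\<close> are irrelevant.
\<close>
definition C_mod :: "(real \<Rightarrow> real) \<Rightarrow> real set \<Rightarrow> (real \<Rightarrow> 'b::banach) set" where
  "C_mod \<mu> I =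
     {f. bdd_above {norm (f t - f s) / \<mu> \<bar>t - s\<bar> | t s. t \<in> I \<and> s \<in> I \<and> 0 < \<bar>t - s\<bar> \<and> \<bar>t - s\<bar> \<le> 1}}"

text \<open>
  Iterated directional derivatives relative to a set \<open>S\<close>; the head of the list is the direction
  differentiated last.  Derivatives are taken within \<open>S\<close>, hence one-sided where \<open>S\<close> has a boundary.
  This is meant for sets such as \<open>[0,1] \<times> \<real>\<^sup>2\<close>, at every point of which the derivative within \<open>S\<close>
  is unique when it exists; only then does \<^const>\<open>frechet_derivative\<close> denote a definite value.
\<close>
primrec iter_deriv :: "'a::euclidean_space set \<Rightarrow> 'a list \<Rightarrow> ('a \<Rightarrow> real) \<Rightarrow> 'a \<Rightarrow> real" where
  "iter_deriv S [] f = f"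
| "iter_deriv S (v # vs) f = (\<lambda>p. frechet_derivative (iter_deriv S vs f) (at p within S) v)"

text \<open>
  Smooth functions on \<open>S\<close> (up to the boundary) all of whose partial derivatives, including the one
  of order zero, are bounded on \<open>S\<close>.  Every iterated partial derivative is required to be Frechet
  differentiable, hence continuous, on \<open>S\<close>.
\<close>
definition Cb_infinity :: "'a::euclidean_space set \<Rightarrow> ('a \<Rightarrow> real) set" where
  "Cb_infinity S =
     {f. \<forall>vs. set vs \<subseteq> Basis \<longrightarrow>
           (iter_deriv S vs f) differentiable_on S \<and> bounded (iter_deriv S vs f ` S)}"

definition slab :: "(real \<times> (real^2)) set" where
  "slab = {0..1} \<times> UNIV"

definition dt :: "(real \<times> (real^2) \<Rightarrow> real) \<Rightarrow> real \<times> (real^2) \<Rightarrow> real" where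
  "dt u = iter_deriv slab [(1, 0)] u"

definition dx :: "2 \<Rightarrow> nat \<Rightarrow> (real \<times> (real^2) \<Rightarrow> real) \<Rightarrow> real \<times> (real^2) \<Rightarrow> real" where
  "dx j k u = iter_deriv slab (replicate k (0, axis j 1)) u"

end

theory Submission
  imports Defs
begin

text \<open>
  The solution is a cascade of plane waves.  Wave \<open>n\<close> has the form \<open>a(t) cos (z\<^sub>n x\<^sub>j)\<close>, with \<open>j = 1\<close> for
  even \<open>n\<close> and \<open>j = 2\<close> for odd \<open>n\<close>.  Wherever it travels freely, the equation without lower order
  terms damps it at the rate \<open>Z\<^sub>n = z\<^sub>n ^ (2 m)\<close> if it runs along \<open>x\<^sub>1\<close>, and at the rate \<open>l(t) Z\<^sub>n\<close> if it
  runs along \<open>x\<^sub>2\<close>.  If the energy can be handed from wave \<open>n\<close> to wave \<open>n + 1\<close> with \<open>Z\<^sub>n \<rightarrow> \<infinity>\<close> quickly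
  enough, the solution dies out at \<open>t = 1\<close> together with all its derivatives.

  A hand-over takes place in a window of length \<open>r\<close>.  First the new wave is switched on while it is
  much smaller than the old one.  Then \<open>l\<close> departs from \<open>1\<close> by an amount of order \<open>\<delta>\<close>, downwards if
  the new wave runs along \<open>x\<^sub>2\<close> and upwards otherwise, so that the quotient of the new wave by the old
  one grows by a factor of about \<open>exp P\<close>, where \<open>P = Z\<^sub>n \<delta> r\<close>.  Finally the old wave, which has become
  the small one, is switched off.  Switching a small wave leaves a residual that is a tiny
  multiple of the dominant wave; since \<open>cos\<close> and \<open>sin\<close> have no common zero, the residual is matched by
  \<open>b \<cdot> \<nabla>u + c u\<close> with coefficients of size \<open>exp (- P / 4)\<close> up to powers of \<open>Z\<^sub>n\<close> (lemma \<open>absorb\<close>).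

  The choice \<open>\<delta> = c \<mu>(r)\<close> puts \<open>l\<close> in the class of modulus \<open>\<mu>\<close> (lemma \<open>l_modulus\<close>).  The rate \<open>Z\<close> may
  then grow by a factor \<open>1 + \<delta> / 4\<close> in each window.  With \<open>Z = r ^ (-3)\<close> this means that consecutive
  windows satisfy \<open>r' = r / (1 + c' \<mu>(r))\<close>, that is \<open>r - r' = c' r' \<mu>(r)\<close>, so the total time \<open>\<Sum> r\<close> is
  dominated by \<open>\<integral> ds / \<mu>(s)\<close>.  This is finite exactly because the Osgood condition fails
  (lemma \<open>summable_scales\<close>).  Concavity gives \<open>\<mu>(r) \<ge> r \<mu>(1)\<close>, hence \<open>P\<close> is at least of order \<open>1 / r\<close>, and
  \<open>exp (- P / 4)\<close> beats every power of \<open>1 / r\<close>.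

  Smoothness is obtained from a calculus of sequences of functions all of whose derivatives are
  bounded by powers of a scale \<open>\<Lambda>\<^sub>n \<ge> 1\<close> (here \<open>\<Lambda>\<^sub>n\<close> is one over the length of the window in which wave
  \<open>n\<close> is switched off).  Such sequences are closed under the operations used in the construction, and
  a series of them with weights decaying faster than every power of \<open>\<Lambda>\<^sub>n\<close> is bounded with all its
  derivatives and can be differentiated term by term (theorem \<open>tame_series\<close>).  This disposes of
  the accumulation of windows at \<open>t = 1\<close> and of the one-sided derivatives there.
\<close>

section \<open>Towers of partial derivatives\<close>

text \<open>
  Every point is a limit, along each coordinate direction, of other points of the set; this is what
  makes a derivative within the set unique, even on the boundary.
\<close>
definition axially_thick :: "'a::euclidean_space set \<Rightarrow> bool" where
  "axially_thick S \<longleftrightarrow> (\<forall>p\<in>S. \<forall>i\<in>Basis. \<forall>e>0. \<exists>d. 0 < \<bar>d\<bar> \<and> \<bar>d\<bar> < e \<and> p + d *\<^sub>R i \<in> S)"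

lemma axially_thick_slab: "axially_thick slab"
  unfolding axially_thick_def
proof (intro ballI allI impI)
  fix p i :: "real \<times> (real^2)" and e :: real
  assume p: "p \<in> slab" and i: "i \<in> Basis" and e: "e > 0"
  obtain t x where px: "p = (t, x)" by (cases p)
  have t: "0 \<le> t" "t \<le> 1" using p px by (auto simp: slab_def)
  have "i \<in> {(1, 0)} \<union> {(0, v) | v. v \<in> Basis}" using i by (auto simp: Basis_prod_def)
  then consider "i = (1, 0)" | v where "i = (0, v)" by auto
  then show "\<exists>d. 0 < \<bar>d\<bar> \<and> \<bar>d\<bar> < e \<and> p + d *\<^sub>R i \<in> slab"
  proof cases
    case 1
    define d where "d = (if t < 1/2 then min (e/2) (1/2) else - min (e/2) (1/2))"
    have "0 < \<bar>d\<bar> \<and> \<bar>d\<bar> < e \<and> 0 \<le> t + d \<and> t + d \<le> 1"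
      using e t by (auto simp: d_def min_def)
    then show ?thesis using 1 px by (intro exI[of _ d]) (auto simp: slab_def)
  next
    case 2
    then show ?thesis using e t px by (intro exI[of _ "e/2"]) (auto simp: slab_def)
  qed
qed

lemma frechet_derivative_thick:
  assumes "axially_thick S" "p \<in> S" "(f has_derivative f') (at p within S)"
  shows "frechet_derivative f (at p within S) = f'"
proof -
  have "f differentiable (at p within S)" using assms(3) by (auto simp: differentiable_def)
  then have "(f has_derivative frechet_derivative f (at p within S)) (at p within S)"
    by (simp add: frechet_derivative_works)
  then show ?thesis
    by (rule frechet_derivative_unique_within[OF _ assms(3)])
      (use assms(1,2) in \<open>auto simp: axially_thick_def\<close>)
qed

text \<open>
  Since derivatives within a thick set are unique, iterated derivatives can be read off from any family
  \<open>D\<close>, indexed by lists of directions, in which each member is differentiable with the next members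
  as its partial derivatives.
\<close>
lemma iter_deriv_tower:
  fixes D :: "'a::euclidean_space list \<Rightarrow> 'a \<Rightarrow> real"
  assumes thick: "axially_thick S"
    and D: "\<And>vs p. set vs \<subseteq> Basis \<Longrightarrow> p \<in> S \<Longrightarrow>
      (D vs has_derivative (\<lambda>h. \<Sum>b\<in>Basis. (h \<bullet> b) * D (b # vs) p)) (at p within S)"
  shows "set vs \<subseteq> Basis \<Longrightarrow>
     (\<forall>p\<in>S. iter_deriv S vs (D []) p = D vs p) \<and> iter_deriv S vs (D []) differentiable_on S"
proof (induction vs)
  case Nil
  then show ?case using D[of "[]"] by (auto simp: differentiable_on_def differentiable_def)
next
  case (Cons v vs)
  then have IH: "iter_deriv S vs (D []) p = D vs p" if "p \<in> S" for p
    using that by auto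
  have eq: "iter_deriv S (v # vs) (D []) p = D (v # vs) p" if p: "p \<in> S" for p
  proof -
    have "(iter_deriv S vs (D []) has_derivative (\<lambda>h. \<Sum>b\<in>Basis. (h \<bullet> b) * D (b # vs) p)) (at p within S)"
      using has_derivative_transform[OF p IH D[of vs p]] Cons.prems p by auto
    then have "iter_deriv S (v # vs) (D []) p = (\<Sum>b\<in>Basis. (v \<bullet> b) * D (b # vs) p)"
      by (simp add: frechet_derivative_thick[OF thick p])
    also have "\<dots> = (\<Sum>b\<in>Basis. if b = v then D (b # vs) p else 0)"
      using Cons.prems by (intro sum.cong) (auto simp: inner_Basis)
    also have "\<dots> = D (v # vs) p" using Cons.prems by simp
    finally show ?thesis .
  qed
  moreover have "iter_deriv S (v # vs) (D []) differentiable_on S"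
    unfolding differentiable_on_def
  proof
    fix p assume p: "p \<in> S"
    have "(iter_deriv S (v # vs) (D []) has_derivative
        (\<lambda>h. \<Sum>b\<in>Basis. (h \<bullet> b) * D (b # v # vs) p)) (at p within S)"
      using has_derivative_transform[OF p eq D[of "v # vs" p]] Cons.prems p by auto
    then show "iter_deriv S (v # vs) (D []) differentiable (at p within S)"
      by (auto simp: differentiable_def)
  qed
  ultimately show ?case by blast
qed

section \<open>Sequences of smooth functions of moderate growth\<close>

definition moderate :: "(nat \<Rightarrow> real) \<Rightarrow> (nat \<Rightarrow> real) \<Rightarrow> bool" where
  "moderate \<Lambda> w \<longleftrightarrow> (\<exists>C k. \<forall>n. \<bar>w n\<bar> \<le> C * \<Lambda> n ^ k)"

definition moderate_on ::
  "(nat \<Rightarrow> real) \<Rightarrow> (nat \<Rightarrow> 'a set) \<Rightarrow> (nat \<Rightarrow> 'a \<Rightarrow> real) \<Rightarrow> bool" where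
  "moderate_on \<Lambda> S F \<longleftrightarrow> (\<exists>w. moderate \<Lambda> w \<and> (\<forall>n. \<forall>p\<in>S n. \<bar>F n p\<bar> \<le> w n))"

text \<open>
  The sets \<open>S n\<close> restrict only the bounds; differentiability is always required on the whole space.
  This allows factors such as \<open>exp (- Z\<^sub>n t)\<close>, which are harmless where a cutoff lives and huge elsewhere.
  The order of differentiation is limited to \<open>k\<close> so that closure properties follow by induction.
\<close>
primrec tame :: "(nat \<Rightarrow> real) \<Rightarrow> (nat \<Rightarrow> 'a::euclidean_space set) \<Rightarrow> nat \<Rightarrow> (nat \<Rightarrow> 'a \<Rightarrow> real) \<Rightarrow> bool"
where
  "tame \<Lambda> S 0 F \<longleftrightarrow> moderate_on \<Lambda> S F"
| "tame \<Lambda> S (Suc k) F \<longleftrightarrow> moderate_on \<Lambda> S F \<and> (\<forall>n p. F n differentiable (at p)) \<and>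
     (\<forall>b\<in>Basis. tame \<Lambda> S k (\<lambda>n p. frechet_derivative (F n) (at p) b))"

lemma tame_moderate_on: "tame \<Lambda> S k F \<Longrightarrow> moderate_on \<Lambda> S F"
  by (cases k) auto

lemma tame_has_derivative:
  "tame \<Lambda> S (Suc k) F \<Longrightarrow> (F n has_derivative frechet_derivative (F n) (at p)) (at p)"
  by (simp add: frechet_derivative_works)

lemma tame_SucI:
  assumes "moderate_on \<Lambda> S F"
    and "\<And>n p. (F n has_derivative D n p) (at p)"
    and "\<And>b. b \<in> Basis \<Longrightarrow> tame \<Lambda> S k (\<lambda>n p. D n p b)"
  shows "tame \<Lambda> S (Suc k) F"
proof -
  have "frechet_derivative (F n) (at p) = D n p" for n p
    using frechet_derivative_at[OF assms(2)] by simp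
  then show ?thesis using assms(1,3) differentiableI[OF assms(2)] by auto
qed

lemma tame_Suc_imp: "tame \<Lambda> S (Suc k) F \<Longrightarrow> tame \<Lambda> S k F"
  by (induction k arbitrary: F) auto

lemma moderate_const [simp]: "moderate \<Lambda> (\<lambda>n. c)"
  unfolding moderate_def by (rule exI[of _ "\<bar>c\<bar>"], rule exI[of _ 0]) simp

lemma moderate_le:
  assumes "moderate \<Lambda> w" "\<And>n. \<bar>v n\<bar> \<le> \<bar>w n\<bar>"
  shows "moderate \<Lambda> v"
  using assms unfolding moderate_def by (meson order_trans)

lemma moderate_power: "(\<And>n. \<Lambda> n \<ge> 0) \<Longrightarrow> moderate \<Lambda> (\<lambda>n. c * \<Lambda> n ^ k)"
  unfolding moderate_def
  by (rule exI[of _ "\<bar>c\<bar>"], rule exI[of _ k]) (simp add: abs_mult)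

lemma moderate_mult:
  assumes "moderate \<Lambda> v" "moderate \<Lambda> w"
  shows "moderate \<Lambda> (\<lambda>n. v n * w n)"
proof -
  obtain C k D l where "\<And>n. \<bar>v n\<bar> \<le> C * \<Lambda> n ^ k" "\<And>n. \<bar>w n\<bar> \<le> D * \<Lambda> n ^ l"
    using assms unfolding moderate_def by blast
  then have "\<bar>v n * w n\<bar> \<le> (C * \<Lambda> n ^ k) * (D * \<Lambda> n ^ l)" for n
    unfolding abs_mult by (intro mult_mono) (auto intro: order_trans[OF abs_ge_zero])
  then have "\<bar>v n * w n\<bar> \<le> (C * D) * \<Lambda> n ^ (k + l)" for n
    by (simp add: power_add mult_ac)
  then show ?thesis unfolding moderate_def by blast
qed

locale growth_scale =
  fixes \<Lambda> :: "nat \<Rightarrow> real"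
  assumes scale_ge_1: "\<And>n. \<Lambda> n \<ge> 1"
begin

lemma scale_power_mono: "k \<le> l \<Longrightarrow> \<Lambda> n ^ k \<le> \<Lambda> n ^ l"
  using scale_ge_1 by (simp add: power_increasing)

lemma moderate_add:
  assumes "moderate \<Lambda> v" "moderate \<Lambda> w"
  shows "moderate \<Lambda> (\<lambda>n. v n + w n)"
proof -
  obtain C k D l where *: "\<And>n. \<bar>v n\<bar> \<le> C * \<Lambda> n ^ k" "\<And>n. \<bar>w n\<bar> \<le> D * \<Lambda> n ^ l"
    using assms unfolding moderate_def by blast
  have "\<bar>v n + w n\<bar> \<le> (\<bar>C\<bar> + \<bar>D\<bar>) * \<Lambda> n ^ (k + l)" for n
  proof -
    have "\<bar>v n\<bar> \<le> \<bar>C\<bar> * \<Lambda> n ^ (k + l)"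
      using *(1)[of n] scale_power_mono[of k "k + l" n] scale_ge_1[of n]
      by (smt (verit) abs_ge_self mult_mono zero_le_power le_add1)
    moreover have "\<bar>w n\<bar> \<le> \<bar>D\<bar> * \<Lambda> n ^ (k + l)"
      using *(2)[of n] scale_power_mono[of l "k + l" n] scale_ge_1[of n]
      by (smt (verit) abs_ge_self mult_mono zero_le_power le_add2)
    ultimately show ?thesis by (simp add: distrib_right)
  qed
  then show ?thesis unfolding moderate_def by blast
qed

lemma moderate_on_add:
  assumes "moderate_on \<Lambda> S F" "moderate_on \<Lambda> S G"
  shows "moderate_on \<Lambda> S (\<lambda>n p. F n p + G n p)"
proof -
  obtain v w where "moderate \<Lambda> v" "moderate \<Lambda> w"
    and *: "\<And>n p. p \<in> S n \<Longrightarrow> \<bar>F n p\<bar> \<le> v n" "\<And>n p. p \<in> S n \<Longrightarrow> \<bar>G n p\<bar> \<le> w n"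
    using assms unfolding moderate_on_def by blast
  moreover have "\<bar>F n p + G n p\<bar> \<le> v n + w n" if "p \<in> S n" for n p
    using *[OF that] by linarith
  ultimately show ?thesis unfolding moderate_on_def
    by (intro exI[of _ "\<lambda>n. v n + w n"]) (auto intro: moderate_add)
qed

lemma moderate_on_mult:
  assumes "moderate_on \<Lambda> S F" "moderate_on \<Lambda> S G"
  shows "moderate_on \<Lambda> S (\<lambda>n p. F n p * G n p)"
proof -
  obtain v w where vw: "moderate \<Lambda> v" "moderate \<Lambda> w"
    and *: "\<And>n p. p \<in> S n \<Longrightarrow> \<bar>F n p\<bar> \<le> v n" "\<And>n p. p \<in> S n \<Longrightarrow> \<bar>G n p\<bar> \<le> w n"
    using assms unfolding moderate_on_def by blast
  have "\<bar>F n p * G n p\<bar> \<le> v n * w n" if "p \<in> S n" for n p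
    unfolding abs_mult using *[OF that]
    by (intro mult_mono) (auto intro: order_trans[OF abs_ge_zero])
  then show ?thesis unfolding moderate_on_def
    by (intro exI[of _ "\<lambda>n. v n * w n"]) (auto intro: moderate_mult vw)
qed

lemma tame_const:
  assumes "moderate \<Lambda> c"
  shows "tame \<Lambda> S k (\<lambda>n p. c n)"
  using assms
proof (induction k arbitrary: c)
  case 0
  then show ?case
    by (auto simp: moderate_on_def intro!: exI[of _ "\<lambda>n. \<bar>c n\<bar>"] intro: moderate_le)
next
  case (Suc k)
  have "moderate_on \<Lambda> S (\<lambda>n p. c n)"
    using Suc.prems by (auto simp: moderate_on_def intro!: exI[of _ "\<lambda>n. \<bar>c n\<bar>"] intro: moderate_le)
  then show ?case
    by (rule tame_SucI[where D = "\<lambda>n p h. 0"]) (auto intro: Suc.IH)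
qed

lemma tame_add:
  "tame \<Lambda> S k F \<Longrightarrow> tame \<Lambda> S k G \<Longrightarrow> tame \<Lambda> S k (\<lambda>n p. F n p + G n p)"
proof (induction k arbitrary: F G)
  case 0 then show ?case by (simp add: moderate_on_add)
next
  case (Suc k)
  note d = tame_has_derivative[OF Suc.prems(1)] tame_has_derivative[OF Suc.prems(2)]
  show ?case
    by (rule tame_SucI[OF _ has_derivative_add[OF d]])
      (use Suc in \<open>auto intro: moderate_on_add\<close>)
qed

lemma tame_mult:
  "tame \<Lambda> S k F \<Longrightarrow> tame \<Lambda> S k G \<Longrightarrow> tame \<Lambda> S k (\<lambda>n p. F n p * G n p)"
proof (induction k arbitrary: F G)
  case 0 then show ?case by (simp add: moderate_on_mult)
next
  case (Suc k)
  note d = tame_has_derivative[OF Suc.prems(1)] tame_has_derivative[OF Suc.prems(2)]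
  have "tame \<Lambda> S k F" "tame \<Lambda> S k G" using Suc.prems tame_Suc_imp by blast+
  then show ?case
    using Suc.prems
    by (intro tame_SucI[OF _ has_derivative_mult[OF d]] tame_add Suc.IH)
      (auto intro: moderate_on_mult)
qed

lemma tame_cmult: "moderate \<Lambda> c \<Longrightarrow> tame \<Lambda> S k F \<Longrightarrow> tame \<Lambda> S k (\<lambda>n p. c n * F n p)"
  by (intro tame_mult tame_const)

lemma tame_minus: "tame \<Lambda> S k F \<Longrightarrow> tame \<Lambda> S k (\<lambda>n p. - F n p)"
  using tame_cmult[of "\<lambda>n. -1" S k F] by simp

lemma tame_diff:
  "tame \<Lambda> S k F \<Longrightarrow> tame \<Lambda> S k G \<Longrightarrow> tame \<Lambda> S k (\<lambda>n p. F n p - G n p)"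
  using tame_add[OF _ tame_minus, of S k F G] by simp

lemma tame_inverse:
  assumes c: "c > 0" and pos: "\<And>n p. F n p \<ge> c" and F: "tame \<Lambda> S k F"
  shows "tame \<Lambda> S k (\<lambda>n p. inverse (F n p))"
proof -
  have "\<bar>inverse (F n p)\<bar> \<le> inverse c" for n p
    using pos[of n p] c by (simp add: le_imp_inverse_le)
  then have bound: "moderate_on \<Lambda> S (\<lambda>n p. inverse (F n p))"
    unfolding moderate_on_def by (intro exI[of _ "\<lambda>n. inverse c"]) auto
  have nz: "F n p \<noteq> 0" for n p using pos[of n p] c by auto
  show ?thesis using F
  proof (induction k)
    case 0 show ?case using bound by simp
  next
    case (Suc k)
    note d = tame_has_derivative[OF Suc.prems]
    have "tame \<Lambda> S k (\<lambda>n p. inverse (F n p))" using Suc tame_Suc_imp by blast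
    then show ?case
      using Suc.prems
      by (intro tame_SucI[OF bound Deriv.has_derivative_inverse[OF nz d]] tame_mult tame_minus) auto
  qed
qed

text \<open>
  A nonpositive exponent keeps the exponential bounded by one, however large the exponent is; only
  its derivatives have to be tame.
\<close>
lemma tame_exp:
  assumes le: "\<And>n p. p \<in> S n \<Longrightarrow> H n p \<le> 0"
    and d: "\<And>n p. (H n has_derivative D n p) (at p)"
    and tm: "\<And>b. b \<in> Basis \<Longrightarrow> tame \<Lambda> S k (\<lambda>n p. D n p b)"
  shows "tame \<Lambda> S k (\<lambda>n p. exp (H n p))"
proof -
  have bound: "moderate_on \<Lambda> S (\<lambda>n p. exp (H n p))"
    unfolding moderate_on_def using le by (intro exI[of _ "\<lambda>n. 1"]) auto
  show ?thesis using tm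
  proof (induction k)
    case 0 show ?case using bound by simp
  next
    case (Suc k)
    have t: "tame \<Lambda> S k (\<lambda>n p. D n p b)" if "b \<in> Basis" for b
      using Suc.prems[OF that] tame_Suc_imp by blast
    then have "tame \<Lambda> S k (\<lambda>n p. exp (H n p))" using Suc.IH by blast
    then show ?case using t
      by (intro tame_SucI[OF bound, where D = "\<lambda>n p h. exp (H n p) * D n p h"]
           tame_mult)
        (auto intro!: derivative_eq_intros d)
  qed
qed

lemma tame_affine:
  fixes F :: "nat \<Rightarrow> real \<Rightarrow> real" and v :: "nat \<Rightarrow> 'a::euclidean_space"
  assumes a: "moderate \<Lambda> a" and v: "\<And>n. norm (v n) \<le> 1"
  shows "tame \<Lambda> (\<lambda>n. UNIV) k F \<Longrightarrow> tame \<Lambda> S k (\<lambda>n p. F n (a n * (p \<bullet> v n) + c n))"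
proof (induction k arbitrary: F)
  case 0 then show ?case by (auto simp: moderate_on_def)
next
  case (Suc k)
  note d = tame_has_derivative[OF Suc.prems]
  have lin: "frechet_derivative (F n) (at x) h = h * frechet_derivative (F n) (at x) 1" for n x h
    using linear_scale[OF has_derivative_linear[OF d], of n x h 1] by simp
  have D: "((\<lambda>p. F n (a n * (p \<bullet> v n) + c n)) has_derivative
     (\<lambda>h. (a n * (h \<bullet> v n)) * frechet_derivative (F n) (at (a n * (p \<bullet> v n) + c n)) 1)) (at p)" for n p
  proof -
    have "((\<lambda>p. a n * (p \<bullet> v n) + c n) has_derivative (\<lambda>h. a n * (h \<bullet> v n))) (at p)"
      by (auto intro!: derivative_eq_intros)
    from has_derivative_compose[OF this d] show ?thesis by (simp add: lin[symmetric])
  qed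
  have "moderate \<Lambda> (\<lambda>n. a n * (b \<bullet> v n))" if "b \<in> Basis" for b :: 'a
  proof (intro moderate_mult a moderate_le[OF moderate_const[of _ 1]])
    fix n show "\<bar>b \<bullet> v n\<bar> \<le> \<bar>1\<bar>"
      using Basis_le_norm[OF that, of "v n"] v[of n] by (simp add: inner_commute)
  qed
  then show ?case
    using Suc.prems by (intro tame_SucI[OF _ D] tame_cmult Suc.IH) (auto simp: moderate_on_def)
qed

text \<open>
  The complement of a closed set is open, so a function vanishing there has vanishing derivatives there:
  bounds on the support are global bounds.
\<close>
lemma tame_support:
  assumes cl: "\<And>n. closed (S n)"
    and F: "tame \<Lambda> S k F" and off: "\<And>n p. p \<notin> S n \<Longrightarrow> F n p = 0"
  shows "tame \<Lambda> S' k F"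
proof -
  have bound: "moderate_on \<Lambda> S' F"
    if mod: "moderate_on \<Lambda> S F" and z: "\<And>n p. p \<notin> S n \<Longrightarrow> F n p = 0" for F
  proof -
    obtain w where w: "moderate \<Lambda> w" "\<forall>n. \<forall>p\<in>S n. \<bar>F n p\<bar> \<le> w n"
      using mod unfolding moderate_on_def by blast
    have "\<bar>F n p\<bar> \<le> \<bar>w n\<bar>" for n p
      using w(2)[rule_format, of p n] z[of p n] by (cases "p \<in> S n") auto
    then show ?thesis unfolding moderate_on_def
      using w(1) by (intro exI[of _ "\<lambda>n. \<bar>w n\<bar>"]) (auto intro: moderate_le)
  qed
  show ?thesis using F off
  proof (induction k arbitrary: F)
    case 0 then show ?case using bound by simp
  next
    case (Suc k)
    have "frechet_derivative (F n) (at p) b = 0" if "p \<notin> S n" for n p b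
    proof -
      have "(F n has_derivative (\<lambda>h. 0)) (at p)"
        by (rule has_derivative_transform_within_open[of "\<lambda>p. 0" _ _ _ "- S n"])
          (use cl that Suc.prems(2) in auto)
      then have "(\<lambda>h. 0) = frechet_derivative (F n) (at p)" by (rule frechet_derivative_at)
      then show ?thesis by metis
    qed
    then show ?case using Suc bound by auto
  qed
qed

lemma tame_iter_deriv:
  assumes "\<And>k. tame \<Lambda> S k F"
  shows "set vs \<subseteq> Basis \<Longrightarrow> tame \<Lambda> S k (\<lambda>n. iter_deriv UNIV vs (F n))"
proof (induction vs arbitrary: k)
  case Nil then show ?case using assms by simp
next
  case (Cons v vs)
  have "tame \<Lambda> S (Suc k) (\<lambda>n. iter_deriv UNIV vs (F n))"
    by (rule Cons.IH) (use Cons.prems in auto)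
  then show ?case using Cons.prems by simp
qed

text \<open>
  The bounds on each derivative are multiplied by weights that absorb any power of \<open>\<Lambda>\<close>, so the series of
  derivatives of every order converge uniformly by the Weierstrass test.  The termwise derivatives form
  a tower in the sense of \<open>iter_deriv_tower\<close>.
\<close>
theorem tame_series:
  fixes F :: "nat \<Rightarrow> 'a::euclidean_space \<Rightarrow> real"
  assumes tm: "\<And>k. tame \<Lambda> (\<lambda>n. UNIV) k F"
    and \<omega>: "\<And>n. \<omega> n \<ge> 0" and sm: "\<And>k. summable (\<lambda>n. \<omega> n * \<Lambda> n ^ k)"
    and S: "convex S" "axially_thick S"
  shows "(\<lambda>p. \<Sum>n. \<omega> n * F n p) \<in> Cb_infinity S"
    and "\<And>vs p. set vs \<subseteq> Basis \<Longrightarrow> p \<in> S \<Longrightarrow>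
       iter_deriv S vs (\<lambda>p. \<Sum>n. \<omega> n * F n p) p = (\<Sum>n. \<omega> n * iter_deriv UNIV vs (F n) p)"
proof -
  define f where "f vs n p = \<omega> n * iter_deriv UNIV vs (F n) p" for vs n p
  define D where "D vs p = (\<Sum>n. f vs n p)" for vs p
  have "\<exists>M. summable M \<and> (\<forall>n p. \<bar>f vs n p\<bar> \<le> M n)" if "set vs \<subseteq> Basis" for vs
  proof -
    have "moderate_on \<Lambda> (\<lambda>n. UNIV) (\<lambda>n. iter_deriv UNIV vs (F n))"
      using tame_moderate_on[OF tame_iter_deriv[OF tm that]] .
    then obtain w where "moderate \<Lambda> w" and w: "\<And>n p. \<bar>iter_deriv UNIV vs (F n) p\<bar> \<le> w n"
      unfolding moderate_on_def by auto
    then obtain C k where "\<And>n. \<bar>w n\<bar> \<le> C * \<Lambda> n ^ k" unfolding moderate_def by blast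
    then have "\<bar>iter_deriv UNIV vs (F n) p\<bar> \<le> C * \<Lambda> n ^ k" for n p
      using w[of n p] by (meson abs_ge_self order_trans)
    then have "\<bar>f vs n p\<bar> \<le> C * (\<omega> n * \<Lambda> n ^ k)" for n p
      using mult_left_mono[OF _ \<omega>, of "\<bar>iter_deriv UNIV vs (F n) p\<bar>" "C * \<Lambda> n ^ k" n] \<omega>[of n]
      by (simp add: f_def abs_mult mult_ac)
    moreover have "summable (\<lambda>n. C * (\<omega> n * \<Lambda> n ^ k))" by (intro summable_mult sm)
    ultimately show ?thesis by blast
  qed
  then obtain M where M: "\<And>vs. set vs \<subseteq> Basis \<Longrightarrow> summable (M vs)"
      "\<And>vs n p. set vs \<subseteq> Basis \<Longrightarrow> \<bar>f vs n p\<bar> \<le> M vs n"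
    by metis
  have sf: "summable (\<lambda>n. f vs n p)" if "set vs \<subseteq> Basis" for vs p
    by (rule summable_comparison_test'[OF M(1)[OF that], of 0]) (use M(2)[OF that] in auto)
  have der: "(D vs has_derivative (\<lambda>h. \<Sum>b\<in>Basis. (h \<bullet> b) * D (b # vs) p)) (at p within S)"
    if vs: "set vs \<subseteq> Basis" and p: "p \<in> S" for vs p
  proof -
    have 1: "(f vs n has_derivative (\<lambda>h. \<Sum>b\<in>Basis. (h \<bullet> b) * f (b # vs) n x)) (at x within S)" for n x
    proof -
      have d: "(iter_deriv UNIV vs (F n) has_derivative frechet_derivative (iter_deriv UNIV vs (F n)) (at x)) (at x)"
        by (rule tame_has_derivative[OF tame_iter_deriv[OF tm vs]])
      have lin: "frechet_derivative (iter_deriv UNIV vs (F n)) (at x) h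
           = (\<Sum>b\<in>Basis. (h \<bullet> b) * iter_deriv UNIV (b # vs) (F n) x)" for h
      proof -
        have l: "linear (frechet_derivative (iter_deriv UNIV vs (F n)) (at x))"
          using d has_derivative_linear by blast
        show ?thesis
          by (subst euclidean_representation[symmetric, of h], subst linear_sum[OF l])
            (simp add: linear_scale[OF l])
      qed
      have "(f vs n has_derivative (\<lambda>h. \<omega> n * frechet_derivative (iter_deriv UNIV vs (F n)) (at x) h)) (at x)"
        unfolding f_def by (intro has_derivative_mult_right d)
      then show ?thesis unfolding lin f_def
        by (simp add: sum_distrib_left mult_ac has_derivative_at_withinI)
    qed
    have 2: "\<forall>\<^sub>F n in sequentially. \<forall>x\<in>S. \<forall>h.
       norm ((\<Sum>i<n. \<Sum>b\<in>Basis. (h \<bullet> b) * f (b # vs) i x) - (\<Sum>b\<in>Basis. (h \<bullet> b) * D (b # vs) x)) \<le> e * norm h"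
      if e: "e > 0" for e
    proof -
      define e' where "e' = e / DIM('a)"
      have e': "e' > 0" using e by (simp add: e'_def)
      have "\<forall>\<^sub>F n in sequentially. \<forall>x. \<bar>(\<Sum>i<n. f (b # vs) i x) - D (b # vs) x\<bar> < e'" if b: "b \<in> Basis" for b
      proof -
        have "uniform_limit UNIV (\<lambda>n x. \<Sum>i<n. f (b # vs) i x) (\<lambda>x. \<Sum>i. f (b # vs) i x) sequentially"
          by (rule Weierstrass_m_test[where M = "M (b # vs)"]) (use M b vs in auto)
        from uniform_limitD[OF this e'] show ?thesis by (simp add: dist_real_def D_def)
      qed
      then have "\<forall>\<^sub>F n in sequentially. \<forall>b\<in>Basis. \<forall>x. \<bar>(\<Sum>i<n. f (b # vs) i x) - D (b # vs) x\<bar> < e'"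
        by (intro eventually_ball_finite) auto
      then show ?thesis
      proof eventually_elim
        case (elim n)
        show ?case
        proof (intro ballI allI)
          fix x h assume "x \<in> S"
          have "(\<Sum>i<n. \<Sum>b\<in>Basis. (h \<bullet> b) * f (b # vs) i x) - (\<Sum>b\<in>Basis. (h \<bullet> b) * D (b # vs) x)
             = (\<Sum>b\<in>Basis. (h \<bullet> b) * ((\<Sum>i<n. f (b # vs) i x) - D (b # vs) x))"
            by (subst sum.swap) (simp add: sum_distrib_left[symmetric] sum_subtractf right_diff_distrib)
          also have "norm \<dots> \<le> (\<Sum>b\<in>(Basis::'a set). norm h * e')"
            unfolding real_norm_def
            by (intro order_trans[OF sum_abs] sum_mono, unfold abs_mult, intro mult_mono)
              (use elim in \<open>auto intro: Basis_le_norm less_imp_le\<close>)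
          also have "\<dots> = e * norm h" by (simp add: e'_def)
          finally show "norm ((\<Sum>i<n. \<Sum>b\<in>Basis. (h \<bullet> b) * f (b # vs) i x) - (\<Sum>b\<in>Basis. (h \<bullet> b) * D (b # vs) x)) \<le> e * norm h" .
        qed
      qed
    qed
    have "\<exists>g. \<forall>x\<in>S. (\<lambda>n. f vs n x) sums (g x) \<and>
        (g has_derivative (\<lambda>h. \<Sum>b\<in>Basis. (h \<bullet> b) * D (b # vs) x)) (at x within S)"
      by (rule has_derivative_series[OF S(1) 1 2 p summable_sums[OF sf[OF vs]]])
    then obtain g where g: "\<And>x. x \<in> S \<Longrightarrow> (\<lambda>n. f vs n x) sums (g x)"
      "\<And>x. x \<in> S \<Longrightarrow> (g has_derivative (\<lambda>h. \<Sum>b\<in>Basis. (h \<bullet> b) * D (b # vs) x)) (at x within S)"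
      by blast
    have "D vs x = g x" if "x \<in> S" for x using g(1)[OF that] by (simp add: D_def sums_iff)
    from has_derivative_transform[OF p this g(2)[OF p]] show ?thesis .
  qed
  have D0: "D [] = (\<lambda>p. \<Sum>n. \<omega> n * F n p)" by (simp add: D_def f_def fun_eq_iff)
  note tower = iter_deriv_tower[where D = D, OF S(2) der, unfolded D0]
  show "iter_deriv S vs (\<lambda>p. \<Sum>n. \<omega> n * F n p) p = (\<Sum>n. \<omega> n * iter_deriv UNIV vs (F n) p)"
    if "set vs \<subseteq> Basis" "p \<in> S" for vs p
    using tower[OF _ _ that(1)] that by (simp add: D_def f_def)
  show "(\<lambda>p. \<Sum>n. \<omega> n * F n p) \<in> Cb_infinity S"
    unfolding Cb_infinity_def
  proof (intro CollectI allI impI conjI)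
    fix vs :: "'a list" assume vs: "set vs \<subseteq> Basis"
    note t = tower[OF _ _ vs]
    show "iter_deriv S vs (\<lambda>p. \<Sum>n. \<omega> n * F n p) differentiable_on S" using t by blast
    have "\<bar>D vs p\<bar> \<le> suminf (M vs)" for p
      unfolding D_def
      by (rule order_trans[OF summable_rabs suminf_le])
        (use M(2)[OF vs] M(1)[OF vs] in \<open>auto intro!: summable_rabs_comparison_test[where g = "M vs"] summable_comparison_test'[OF M(1)[OF vs], of 0]\<close>)
    then show "bounded (iter_deriv S vs (\<lambda>p. \<Sum>n. \<omega> n * F n p) ` S)"
      using t by (auto simp: bounded_iff intro!: exI[of _ "suminf (M vs)"])
  qed
qed

end

section \<open>A smooth step\<close>

text \<open>
  The functions \<open>x ^ (-j) exp (- 1 / x)\<close> arise as the derivatives of \<open>exp (- 1 / x)\<close>; the whole family is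
  closed under differentiation up to linear combinations, so all orders are treated at once.
\<close>
definition flat :: "nat \<Rightarrow> real \<Rightarrow> real" where
  "flat j x = (if x > 0 then (1/x) ^ j * exp (- 1/x) else 0)"

lemma power_le_fact_exp:
  fixes y :: real assumes "y \<ge> 0" shows "y ^ j \<le> fact j * exp y"
proof -
  have "(\<Sum>n\<in>{j}. y ^ n /\<^sub>R fact n) \<le> exp y"
    unfolding exp_def by (rule sum_le_suminf) (use assms summable_exp_generic[of y] in \<open>auto intro!: scaleR_nonneg_nonneg simp del: real_scaleR_def\<close>)
  then show ?thesis by (simp add: field_simps)
qed

lemma flat_bounds: "0 \<le> flat j x" "flat j x \<le> fact j"
proof -
  show "0 \<le> flat j x" by (simp add: flat_def)
  have "(1/x) ^ j * exp (- 1/x) \<le> fact j" if "x > 0"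
    using power_le_fact_exp[of "1/x" j] that by (simp add: exp_minus field_simps)
  then show "flat j x \<le> fact j" by (simp add: flat_def)
qed

lemma flat_shift: "flat j x = x ^ k * flat (j + k) x"
  by (simp add: flat_def power_add power_one_over field_simps)

text \<open>
  Smoothness at the origin: \<open>flat j\<close> is \<open>x\<^sup>2\<close> times the bounded function \<open>flat (j + 2)\<close>.
\<close>
lemma DERIV_flat: "(flat j has_real_derivative flat (j + 2) x - j * flat (j + 1) x) (at x)"
proof (cases "x = 0")
  case True
  have "((\<lambda>h. (flat j (0 + h) - flat j 0) / h) \<longlongrightarrow> 0) (at 0)"
  proof (rule Lim_null_comparison)
    show "\<forall>\<^sub>F h in at 0. norm ((flat j (0 + h) - flat j 0) / h) \<le> fact (j + 2) * \<bar>h\<bar>"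
    proof (rule always_eventually, rule allI)
      fix h :: real
      have "\<bar>flat j h\<bar> \<le> h\<^sup>2 * fact (j + 2)"
        using flat_bounds[of "j + 2" h] by (subst flat_shift[of j h 2]) (simp add: abs_mult mult_left_mono)
      moreover have "flat j 0 = 0" by (simp add: flat_def)
      ultimately show "norm ((flat j (0 + h) - flat j 0) / h) \<le> fact (j + 2) * \<bar>h\<bar>"
        using abs_mult_self_eq[of h]
        by (cases "h = 0") (auto simp: divide_le_eq power2_eq_square mult_ac simp del: abs_mult_self_eq fact_Suc)
    qed
    show "((\<lambda>h. fact (j + 2) * \<bar>h\<bar>) \<longlongrightarrow> 0) (at (0::real))"
      by (intro tendsto_eq_intros) auto
  qed
  then show ?thesis using True by (simp add: DERIV_def flat_def)
next
  case False
  then consider "x < 0" | "x > 0" by linarith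
  then show ?thesis
  proof cases
    case 1
    have "((\<lambda>x. 0) has_real_derivative 0) (at x)" by simp
    then have "(flat j has_real_derivative 0) (at x)"
      by (rule has_field_derivative_transform_within_open[where S = "{..<0}"]) (use 1 in \<open>auto simp: flat_def\<close>)
    then show ?thesis using 1 by (simp add: flat_def)
  next
    case 2
    have pow: "((\<lambda>x. (1/x) ^ j) has_real_derivative - (j * (1/x) ^ (j + 1))) (at x)"
    proof (induction j)
      case (Suc j)
      have recip: "((\<lambda>x. 1/x) has_real_derivative - ((1/x) ^ 2)) (at x)"
        using 2 by (auto intro!: derivative_eq_intros simp: field_simps power2_eq_square)
      have "((\<lambda>x. 1/x * (1/x) ^ j) has_real_derivative - (real (Suc j) * (1/x) ^ (Suc j + 1))) (at x)"
        by (rule DERIV_cong[OF DERIV_mult[OF recip Suc]]) (simp add: algebra_simps power2_eq_square add_divide_distrib)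
      then show ?case by (simp only: power_Suc)
    qed simp
    have "((\<lambda>x. exp (- 1/x)) has_real_derivative exp (- 1/x) * (1/x) ^ 2) (at x)"
      using 2 by (auto intro!: derivative_eq_intros simp: field_simps power2_eq_square)
    from DERIV_mult[OF pow this]
    have "((\<lambda>x. (1/x) ^ j * exp (- 1/x)) has_real_derivative flat (j + 2) x - j * flat (j + 1) x) (at x)"
      using 2 by (simp add: flat_def power2_eq_square field_simps)
    then show ?thesis
      by (rule has_field_derivative_transform_within_open[where S = "{0<..}"]) (use 2 in \<open>auto simp: flat_def\<close>)
  qed
qed

text \<open>
  The quotient makes the step antisymmetric about \<open>1/2\<close>, which identifies switching off with
  switching on in reversed time.
\<close>
definition step :: "real \<Rightarrow> real" where
  "step x = flat 0 x * inverse (flat 0 x + flat 0 (1 - x))"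

lemma step_denominator: "exp (- 2) \<le> flat 0 x + flat 0 (1 - x)"
proof -
  have *: "exp (- 2) \<le> flat 0 y" if "y \<ge> 1/2" for y
    using that by (simp add: flat_def field_simps)
  consider "x \<ge> 1/2" | "1 - x \<ge> 1/2" by linarith
  then show ?thesis by cases (use * flat_bounds(1) in \<open>smt (verit)\<close>)+
qed

lemma step_eq_0: "x \<le> 0 \<Longrightarrow> step x = 0"
  by (simp add: step_def flat_def)

lemma step_symmetric: "step (1 - x) = 1 - step x"
proof -
  have "flat 0 x + flat 0 (1 - x) \<noteq> 0"
    using step_denominator[of x] exp_gt_zero[of "-2::real"] by linarith
  then show ?thesis by (simp add: step_def field_simps)
qed

lemma step_eq_1: "x \<ge> 1 \<Longrightarrow> step x = 1"
  using step_symmetric[of x] step_eq_0[of "1 - x"] by simp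

lemma step_nonneg: "0 \<le> step x"
  by (simp add: step_def flat_bounds)

lemma step_le_1: "step x \<le> 1"
  using step_nonneg[of "1 - x"] step_symmetric[of x] by simp

lemma has_derivative_imp_deriv:
  fixes f :: "real \<Rightarrow> real"
  assumes "f differentiable (at x)"
  shows "(f has_real_derivative deriv f x) (at x)" "frechet_derivative f (at x) 1 = deriv f x"
proof -
  obtain d where d: "(f has_real_derivative d) (at x)"
    using assms real_differentiable_def by blast
  then have "d = deriv f x" using DERIV_imp_deriv by blast
  with d show "(f has_real_derivative deriv f x) (at x)" by simp
  then have "(f has_derivative (\<lambda>h. deriv f x * h)) (at x)"
    by (simp add: has_field_derivative_def)
  then show "frechet_derivative f (at x) 1 = deriv f x"
    by (simp add: frechet_derivative_at[symmetric])
qed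

lemma (in growth_scale) tame_deriv:
  assumes "tame \<Lambda> S (Suc k) F"
  shows "tame \<Lambda> S k (\<lambda>n. deriv (F n))"
proof -
  have "frechet_derivative (F n) (at p) 1 = deriv (F n) p" for n p
    using assms by (intro has_derivative_imp_deriv) simp
  then have "(\<lambda>n p. frechet_derivative (F n) (at p) 1) = (\<lambda>n. deriv (F n))" by (simp add: fun_eq_iff)
  then show ?thesis using assms by simp
qed

text \<open>
  Derivatives of the cosine are shifts of it by \<open>\<pi>/2\<close>; with a free shift the induction closes.
\<close>
lemma (in growth_scale) tame_cos_shift: "tame \<Lambda> S k (\<lambda>n x. cos (x + c))"
proof (induction k arbitrary: c)
  case 0
  show ?case by (auto simp: moderate_on_def intro!: exI[of _ "\<lambda>n. 1"])
next
  case (Suc k)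
  have "moderate_on \<Lambda> S (\<lambda>n x. cos (x + c))"
    unfolding moderate_on_def by (auto intro!: exI[of _ "\<lambda>n. 1"])
  moreover have "((\<lambda>x. cos (x + c)) has_derivative (\<lambda>h. h * cos (x + (c + pi/2)))) (at x)" for x
    using minus_sin_cos_eq[of "x + c"] by (auto intro!: derivative_eq_intros simp: add.assoc)
  moreover have "tame \<Lambda> S k (\<lambda>n (p::real). b * cos (p + (c + pi/2)))" for b
    by (intro tame_cmult moderate_const Suc.IH)
  ultimately show ?case by (rule tame_SucI)
qed

lemma (in growth_scale) tame_flat: "tame \<Lambda> S k (\<lambda>n. flat j)"
proof (induction k arbitrary: j)
  case 0
  then show ?case using flat_bounds by (auto simp: moderate_on_def intro!: exI[of _ "\<lambda>n. fact j"])
next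
  case (Suc k)
  have "moderate_on \<Lambda> S (\<lambda>n. flat j)"
    using flat_bounds by (auto simp: moderate_on_def intro!: exI[of _ "\<lambda>n. fact j"])
  moreover have "(flat j has_derivative (\<lambda>h. (flat (j + 2) p - real j * flat (j + 1) p) * h)) (at p)" for p
    using DERIV_flat[of j p] by (simp only: has_field_derivative_def)
  moreover have "tame \<Lambda> S k (\<lambda>n p. (flat (j + 2) p - real j * flat (j + 1) p) * b)" for b
    by (intro tame_mult tame_diff tame_cmult tame_const moderate_const Suc.IH)
  ultimately show ?case by (rule tame_SucI)
qed

lemma (in growth_scale) tame_step: "tame \<Lambda> S k (\<lambda>n. step)"
proof -
  have "tame \<Lambda> S k (\<lambda>n p. flat 0 ((-1) * (p \<bullet> (1::real)) + 1))"
    by (rule tame_affine[OF moderate_const _ tame_flat]) simp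
  then have "tame \<Lambda> S k (\<lambda>n p. flat 0 (1 - p))" by simp
  then show ?thesis unfolding step_def[abs_def]
    using step_denominator by (intro tame_mult tame_flat tame_inverse[of "exp (-2)"] tame_add) auto
qed

lemma step_smooth:
  "step differentiable (at x)" "deriv step differentiable (at x)"
  "\<exists>B. \<forall>x. \<bar>deriv step x\<bar> \<le> B" "\<exists>B. \<forall>x. \<bar>deriv (deriv step) x\<bar> \<le> B"
proof -
  interpret growth_scale "\<lambda>n. 1" by standard simp
  have bnd: "\<exists>B. \<forall>x. \<bar>f x\<bar> \<le> B" if "tame (\<lambda>n. 1) (\<lambda>n. UNIV) k (\<lambda>n. f)" for k and f :: "real \<Rightarrow> real"
    using tame_moderate_on[OF that] by (auto simp: moderate_on_def)
  have 1: "tame (\<lambda>n. 1) (\<lambda>n. UNIV) (Suc (Suc 0)) (\<lambda>n. step)" by (rule tame_step)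
  then show "step differentiable (at x)" unfolding tame.simps(2) by blast
  have 2: "tame (\<lambda>n. 1) (\<lambda>n. UNIV) (Suc 0) (\<lambda>n. deriv step)" by (rule tame_deriv[OF 1])
  then show "deriv step differentiable (at x)" unfolding tame.simps(2) by blast
  show "\<exists>B. \<forall>x. \<bar>deriv step x\<bar> \<le> B" using bnd[OF 2] .
  show "\<exists>B. \<forall>x. \<bar>deriv (deriv step) x\<bar> \<le> B" using bnd[OF tame_deriv[OF 2]] .
qed

lemmas DERIV_step = has_derivative_imp_deriv(1)[OF step_smooth(1)]

text \<open>
  The step attains its global minimum at all \<open>x \<le> 0\<close> and its global maximum at all \<open>x \<ge> 1\<close>.
\<close>
lemma deriv_step_eq_0:
  assumes "x \<le> 0 \<or> x \<ge> 1" shows "deriv step x = 0"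
  using assms
proof
  assume "x \<le> 0"
  then show ?thesis
    by (intro DERIV_local_min[OF DERIV_step, of 1]) (auto simp: step_eq_0 step_nonneg)
next
  assume "x \<ge> 1"
  then show ?thesis
    by (intro DERIV_local_max[OF DERIV_step, of 1]) (auto simp: step_eq_1 step_le_1)
qed

lemma deriv_step_bound:
  obtains B where "B \<ge> 1" "\<And>x. \<bar>deriv step x\<bar> \<le> B" "\<And>x y. \<bar>deriv step x - deriv step y\<bar> \<le> B * \<bar>x - y\<bar>"
proof -
  obtain B1 B2 where B: "\<And>x. \<bar>deriv step x\<bar> \<le> B1" "\<And>x. \<bar>deriv (deriv step) x\<bar> \<le> B2"
    using step_smooth(3,4) by blast
  define B where "B = max 1 (max B1 B2)"
  have "norm (deriv step x - deriv step y) \<le> B * norm (x - y)" for x y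
    by (rule field_differentiable_bound[of UNIV "deriv step" "deriv (deriv step)"])
      (use B(2) in \<open>auto simp: B_def le_max_iff_disj intro: has_derivative_imp_deriv(1)[OF step_smooth(2)]\<close>)
  moreover have "\<bar>deriv step x\<bar> \<le> B" for x using B(1)[of x] by (simp add: B_def le_max_iff_disj)
  moreover have "B \<ge> 1" by (simp add: B_def)
  ultimately show ?thesis using that by auto
qed

section \<open>Scales from the failure of the Osgood condition\<close>

lemma concave_ge_chord:
  fixes \<mu> :: "real \<Rightarrow> real"
  assumes "concave_on {0..1} \<mu>" "\<mu> 0 = 0" "0 \<le> d" "d \<le> y" "0 < y" "y \<le> 1"
  shows "d / y * \<mu> y \<le> \<mu> d"
proof -
  have "(1 - d/y) * \<mu> 0 + d/y * \<mu> y \<le> \<mu> ((1 - d/y) *\<^sub>R 0 + (d/y) *\<^sub>R y)"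
    by (rule concave_onD[OF assms(1)]) (use assms in auto)
  then show ?thesis using assms by simp
qed

text \<open>
  The recursion is \<open>y - y' = c y' \<mu>(y)\<close>, a discrete version of \<open>dy / dn = - c y \<mu>(y)\<close>.
\<close>
primrec scales :: "(real \<Rightarrow> real) \<Rightarrow> real \<Rightarrow> real \<Rightarrow> nat \<Rightarrow> real" where
  "scales \<mu> c y0 0 = y0"
| "scales \<mu> c y0 (Suc n) = scales \<mu> c y0 n / (1 + c * \<mu> (scales \<mu> c y0 n))"

locale modulus =
  fixes \<mu> :: "real \<Rightarrow> real"
  assumes range: "\<mu> ` {0..1} \<subseteq> {0..1}"
    and concave: "concave_on {0..1} \<mu>"
    and strict_mono: "strict_mono_on {0..1} \<mu>"
    and zero [simp]: "\<mu> 0 = 0"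
begin

lemma pos: "0 < s \<Longrightarrow> s \<le> 1 \<Longrightarrow> 0 < \<mu> s"
  using strict_mono_onD[OF strict_mono, of 0 s] by simp

lemma le_1: "0 \<le> s \<Longrightarrow> s \<le> 1 \<Longrightarrow> \<mu> s \<le> 1"
  using range by (auto simp: image_subset_iff)

lemma nonneg: "0 \<le> s \<Longrightarrow> s \<le> 1 \<Longrightarrow> 0 \<le> \<mu> s"
  using range by (auto simp: image_subset_iff)

lemma mono: "0 \<le> s \<Longrightarrow> s \<le> t \<Longrightarrow> t \<le> 1 \<Longrightarrow> \<mu> s \<le> \<mu> t"
  using strict_mono_onD[OF strict_mono, of s t] by (cases "s = t") auto

lemma ge_linear: "0 \<le> s \<Longrightarrow> s \<le> 1 \<Longrightarrow> s * \<mu> 1 \<le> \<mu> s"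
  using concave_ge_chord[OF concave zero, of s 1] by simp

lemma scales_bounds:
  assumes "0 < y0" "y0 \<le> 1" "0 < c"
  shows "0 < scales \<mu> c y0 n" "scales \<mu> c y0 n \<le> y0" "scales \<mu> c y0 (Suc n) \<le> scales \<mu> c y0 n"
proof -
  have *: "0 < scales \<mu> c y0 n \<and> scales \<mu> c y0 n \<le> y0" for n
  proof (induction n)
    case 0 then show ?case using assms by simp
  next
    case (Suc n)
    then have "0 < \<mu> (scales \<mu> c y0 n)" using assms by (intro pos) auto
    then have a: "0 < c * \<mu> (scales \<mu> c y0 n)" using assms by simp
    then have "scales \<mu> c y0 (Suc n) \<le> scales \<mu> c y0 n / 1"
      using Suc unfolding scales.simps by (intro divide_left_mono) auto
    then show ?case using Suc a by (auto intro!: divide_pos_pos)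
  qed
  then show 1: "0 < scales \<mu> c y0 n" "scales \<mu> c y0 n \<le> y0" by auto
  have "0 \<le> \<mu> (scales \<mu> c y0 n)" using 1 assms by (intro nonneg) auto
  then have "0 \<le> c * \<mu> (scales \<mu> c y0 n)" using assms by simp
  then have "scales \<mu> c y0 (Suc n) \<le> scales \<mu> c y0 n / 1"
    using 1 unfolding scales.simps by (intro divide_left_mono) auto
  then show "scales \<mu> c y0 (Suc n) \<le> scales \<mu> c y0 n" by simp
qed

text \<open>
  The lengths telescope against the integral of \<open>1 / \<mu>\<close>: on \<open>(y', y]\<close> the integrand is at least \<open>1 / \<mu>(y)\<close>,
  and \<open>(y - y') / \<mu>(y) = c y'\<close>.  The sum of the \<open>c y'\<close> is thus the integral of a step function below
  \<open>1 / \<mu>\<close>.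
\<close>
lemma summable_scales:
  assumes "\<not> osgood \<mu>" and y0: "0 < y0" "y0 \<le> 1" and c: "0 < c"
  shows "summable (scales \<mu> c y0)"
proof -
  define y where "y = scales \<mu> c y0"
  note b = scales_bounds[OF y0 c, folded y_def]
  have mu: "0 < \<mu> (y n)" for n using b(1,2)[of n] y0 by (intro pos) auto
  have anti: "y m \<le> y n" if "n \<le> m" for n m
    using lift_Suc_antimono_le[of y, OF b(3) that] .
  have step: "c * y (Suc n) = (y n - y (Suc n)) / \<mu> (y n)" for n
  proof -
    have "1 + c * \<mu> (y n) > 0" using mu[of n] c by (simp add: add_pos_pos)
    moreover have "y (Suc n) = y n / (1 + c * \<mu> (y n))" by (simp add: y_def)
    ultimately have "y (Suc n) * (1 + c * \<mu> (y n)) = y n" by (simp add: field_simps)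
    then show ?thesis using mu[of n] by (simp add: field_simps)
  qed
  define I where "I = (\<integral>\<^sup>+ s\<in>{0..1}. (1 / ennreal (\<mu> s)) \<partial>lborel)"
  have I: "I < \<infinity>" using assms(1) unfolding osgood_def I_def by (simp add: top.not_eq_extremum)
  have le: "ennreal (\<Sum>n<N. c * y (Suc n)) \<le> I" for N
  proof -
    let ?g = "\<lambda>n s. ennreal (1 / \<mu> (y n)) * indicator {y (Suc n)<..y n} s"
    have "ennreal (\<Sum>n<N. c * y (Suc n)) = (\<Sum>n<N. ennreal (c * y (Suc n)))"
      using b(1) c by (intro sum_ennreal[symmetric]) (auto intro: less_imp_le)
    also have "\<dots> = (\<Sum>n<N. \<integral>\<^sup>+ s. ?g n s \<partial>lborel)"
    proof (intro sum.cong refl)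
      fix n
      have "(\<integral>\<^sup>+ s. ?g n s \<partial>lborel) = ennreal (1 / \<mu> (y n)) * ennreal (y n - y (Suc n))"
        using b(3)[of n] by (simp add: nn_integral_cmult_indicator)
      also have "\<dots> = ennreal (1 / \<mu> (y n) * (y n - y (Suc n)))"
        using b(3)[of n] mu[of n] by (intro ennreal_mult[symmetric]) auto
      finally show "ennreal (c * y (Suc n)) = (\<integral>\<^sup>+ s. ?g n s \<partial>lborel)"
        using step[of n] by simp
    qed
    also have "\<dots> = (\<integral>\<^sup>+ s. (\<Sum>n<N. ?g n s) \<partial>lborel)"
      by (intro nn_integral_sum[symmetric]) auto
    also have "\<dots> \<le> I"
      unfolding I_def
    proof (intro nn_integral_mono)
      fix s
      show "(\<Sum>n<N. ?g n s) \<le> 1 / ennreal (\<mu> s) * indicator {0..1} s"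
      proof (cases "\<exists>n<N. s \<in> {y (Suc n)<..y n}")
        case False
        then have "(\<Sum>n<N. ?g n s) = 0" by (intro sum.neutral) auto
        then show ?thesis by simp
      next
        case True
        then obtain n where n: "n < N" "s \<in> {y (Suc n)<..y n}" by blast
        have s: "0 < s" "s \<le> 1" "s \<le> y n" using n b(1)[of "Suc n"] b(2)[of n] y0 by auto
        have "?g m s = 0" if "m \<noteq> n" for m
        proof -
          from that consider "Suc m \<le> n" | "Suc n \<le> m" by linarith
          then have "s \<notin> {y (Suc m)<..y m}"
            by cases (use anti[of "Suc m" n] anti[of "Suc n" m] n in auto)
          then show ?thesis by simp
        qed
        then have "(\<Sum>m<N. ?g m s) = (\<Sum>m<N. if m = n then ?g n s else 0)"
          by (intro sum.cong) auto
        also have "\<dots> = ?g n s" using n(1) by simp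
        also have "\<dots> = ennreal (1 / \<mu> (y n))" using n(2) by simp
        also have "\<dots> \<le> ennreal (1 / \<mu> s)"
          using mono[of s "y n"] s b(2)[of n] y0 pos[of s] mu[of n]
          by (intro ennreal_leI divide_left_mono) auto
        also have "\<dots> = 1 / ennreal (\<mu> s) * indicator {0..1} s"
          using s pos[of s] divide_ennreal[of 1 "\<mu> s"] by simp
        finally show ?thesis .
      qed
    qed
    finally show ?thesis .
  qed
  have "(\<Sum>n<N. norm (y (Suc n))) \<le> enn2real I / c" for N
  proof -
    have "(\<Sum>n<N. c * y (Suc n)) \<ge> 0"
      using b(1) c by (intro sum_nonneg) (auto intro: less_imp_le)
    then have "(\<Sum>n<N. c * y (Suc n)) \<le> enn2real I"
      using enn2real_mono[OF le[of N]] I by simp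
    moreover have "(\<Sum>n<N. c * y (Suc n)) = c * (\<Sum>n<N. norm (y (Suc n)))"
      using b(1) by (simp add: sum_distrib_left less_imp_le)
    ultimately show ?thesis using c by (simp add: field_simps)
  qed
  then have "summable (\<lambda>n. norm (y (Suc n)))"
    by (intro summableI_nonneg_bounded) auto
  then have "summable (\<lambda>n. y (Suc n))" by (rule summable_norm_cancel)
  then show ?thesis using summable_Suc_iff[of y] by (simp only: y_def)
qed

end

text \<open>
  The factor \<open>exp (- a / y)\<close> is smaller than every power of \<open>y\<close>; one power more than needed is spent
  on the summability of \<open>y\<close>.
\<close>
lemma summable_exp_weight:
  fixes y \<kappa> :: "nat \<Rightarrow> real"
  assumes y: "summable y" "\<And>n. y n > 0" and a: "a > 0" and \<kappa>: "\<And>n. a / y n \<le> \<kappa> n"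
  shows "summable (\<lambda>n. exp (- \<kappa> n) * (1 / y n) ^ k)"
proof (rule summable_comparison_test')
  show "summable (\<lambda>n. fact (Suc k) / a ^ Suc k * y n)" by (intro summable_mult y)
  fix n :: nat
  have "(a / y n) ^ Suc k \<le> fact (Suc k) * exp (a / y n)"
    using power_le_fact_exp[of "a / y n" "Suc k"] a y(2)[of n] by simp
  also have "\<dots> \<le> fact (Suc k) * exp (\<kappa> n)"
    using \<kappa>[of n] by (intro mult_left_mono) auto
  finally have "exp (- \<kappa> n) * (a / y n) ^ Suc k \<le> exp (- \<kappa> n) * (fact (Suc k) * exp (\<kappa> n))"
    by (intro mult_left_mono) auto
  also have "\<dots> = fact (Suc k)" by (simp add: exp_minus del: fact_Suc)
  finally have "exp (- \<kappa> n) * (a / y n) ^ Suc k \<le> fact (Suc k)" .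
  moreover have "exp (- \<kappa> n) * (1 / y n) ^ k = exp (- \<kappa> n) * (a / y n) ^ Suc k * (y n / a ^ Suc k)"
    using a y(2)[of n] by (simp add: power_divide field_simps)
  ultimately have "exp (- \<kappa> n) * (1 / y n) ^ k \<le> fact (Suc k) * (y n / a ^ Suc k)"
    using a y(2)[of n] by (simp only: mult_right_mono divide_nonneg_pos less_imp_le zero_less_power)
  then show "norm (exp (- \<kappa> n) * (1 / y n) ^ k) \<le> fact (Suc k) / a ^ Suc k * y n"
    using y(2)[of n] by simp
qed

section \<open>Absorbing a small wave\<close>

text \<open>
  Amplitude, relative to the dominant wave and up to a constant factor, of a wave that is being switched
  on; \<open>Y\<close> is the time in units of the window, and the switching happens for \<open>0 \<le> Y \<le> 1/3\<close>.  The function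
  \<open>rise_rate\<close> is the part of the derivative that comes from the cutoff.  It is the residual in the
  equation, since the derivative of the exponential is the damping of the wave.
\<close>
definition rise :: "real \<Rightarrow> real \<Rightarrow> real \<Rightarrow> real" where
  "rise \<kappa> D Y = step (3 * Y) * exp (- \<kappa> - D * Y)"

definition rise_rate :: "real \<Rightarrow> real \<Rightarrow> real \<Rightarrow> real" where
  "rise_rate \<kappa> D Y = 3 * deriv step (3 * Y) * exp (- \<kappa> - D * Y)"

text \<open>
  The coefficients that absorb the residual \<open>W \<sigma> cos \<phi>\<close> of the small wave \<open>W \<rho> cos \<phi>\<close> in presence of the dominant
  wave \<open>cos \<theta>\<close>.  They are \<open>- \<sigma> cos \<phi>\<close> times \<open>cos \<theta>\<close> and \<open>- sin \<theta>\<close>, respectively, up to the factor that corrects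
  for the fact that the zero-order coefficient also meets the small wave.
\<close>
definition absorb_c :: "real \<Rightarrow> real \<Rightarrow> real \<Rightarrow> real \<Rightarrow> real \<Rightarrow> real" where
  "absorb_c W \<rho> \<sigma> \<phi> \<theta> = - (\<sigma> * cos \<phi> * cos \<theta> * inverse (1 + W * \<rho> * (cos \<phi> * cos \<theta>)))"

definition absorb_b :: "real \<Rightarrow> real \<Rightarrow> real \<Rightarrow> real \<Rightarrow> real \<Rightarrow> real" where
  "absorb_b W \<rho> \<sigma> \<phi> \<theta> = \<sigma> * cos \<phi> * sin \<theta> * inverse (1 + W * \<rho> * (cos \<phi> * cos \<theta>))"

lemma rise_bounds:
  assumes "\<kappa> \<ge> 0" "D \<ge> 0" shows "0 \<le> rise \<kappa> D Y" "rise \<kappa> D Y \<le> 1"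
proof -
  show "0 \<le> rise \<kappa> D Y" by (simp add: rise_def step_nonneg)
  show "rise \<kappa> D Y \<le> 1"
  proof (cases "Y \<le> 0")
    case False
    then have "0 \<le> D * Y" using assms by simp
    then have "exp (- \<kappa> - D * Y) \<le> 1" using assms by simp
    then show ?thesis unfolding rise_def using mult_mono[OF step_le_1, of "exp (- \<kappa> - D * Y)" 1] by simp
  qed (simp add: rise_def step_eq_0)
qed

lemma absorb_denominator:
  fixes W \<rho> \<phi> \<theta> :: real
  assumes "0 \<le> W" "W \<le> 1/2" "\<bar>\<rho>\<bar> \<le> 1"
  shows "1/2 \<le> 1 + W * \<rho> * (cos \<phi> * cos \<theta>)"
proof -
  have "\<bar>W * \<rho> * (cos \<phi> * cos \<theta>)\<bar> \<le> (1/2 * 1) * (1 * 1)"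
    unfolding abs_mult using assms by (intro mult_mono) auto
  then show ?thesis by (simp add: abs_le_iff)
qed

text \<open>
  In the bracket \<open>cos\<^sup>2 \<theta> + sin\<^sup>2 \<theta>\<close> appears, which is why a term of first order is used besides
  the term of order zero: \<open>cos \<theta>\<close> alone has zeros.
\<close>
lemma absorb:
  assumes "1 + W * \<rho> * (cos \<phi> * cos \<theta>) \<noteq> 0"
  shows "absorb_c W \<rho> \<sigma> \<phi> \<theta> * (cos \<theta> + W * \<rho> * cos \<phi>) - absorb_b W \<rho> \<sigma> \<phi> \<theta> * sin \<theta> = - (\<sigma> * cos \<phi>)"
proof -
  define h where "h = inverse (1 + W * \<rho> * (cos \<phi> * cos \<theta>))"
  have h: "(1 + W * \<rho> * (cos \<phi> * cos \<theta>)) * h = 1" using assms by (simp add: h_def)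
  have "absorb_c W \<rho> \<sigma> \<phi> \<theta> * (cos \<theta> + W * \<rho> * cos \<phi>) - absorb_b W \<rho> \<sigma> \<phi> \<theta> * sin \<theta>
     = - (\<sigma> * cos \<phi>) * (((cos \<theta>)\<^sup>2 + (sin \<theta>)\<^sup>2 + W * \<rho> * (cos \<phi> * cos \<theta>)) * h)"
    unfolding absorb_c_def absorb_b_def h_def[symmetric] power2_eq_square by algebra
  also have "\<dots> = - (\<sigma> * cos \<phi>)" using h by simp
  finally show ?thesis .
qed

lemma (in growth_scale) tame_rise:
  assumes \<kappa>: "\<And>n. \<kappa> n \<ge> 0" and D: "\<And>n. D n \<ge> 0" "moderate \<Lambda> D"
  shows "tame \<Lambda> S k (\<lambda>n. rise (\<kappa> n) (D n))" "tame \<Lambda> S k (\<lambda>n. rise_rate (\<kappa> n) (D n))"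
proof -
  have ex: "tame \<Lambda> (\<lambda>n. {0..}) k (\<lambda>n Y. exp (- \<kappa> n - D n * Y))" for k
  proof (rule tame_exp)
    show "- \<kappa> n - D n * Y \<le> 0" if "Y \<in> {0..}" for n Y
      using that \<kappa>[of n] mult_nonneg_nonneg[OF D(1)[of n], of Y] by simp
    show "((\<lambda>Y. - \<kappa> n - D n * Y) has_derivative (\<lambda>h. - D n * h)) (at p)" for n p
      by (auto intro!: derivative_eq_intros)
    have "moderate \<Lambda> (\<lambda>n. - D n * b)" for b
      by (intro moderate_mult moderate_const moderate_le[OF D(2)]) auto
    then show "tame \<Lambda> (\<lambda>n. {0..}) k (\<lambda>n p. - D n * b)" for b
      by (rule tame_const)
  qed
  have aff: "tame \<Lambda> (\<lambda>n. {0..}) k (\<lambda>n Y. f (3 * Y))" if "\<And>k. tame \<Lambda> (\<lambda>n. UNIV) k (\<lambda>n. f)" for f :: "real \<Rightarrow> real" and k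
    using tame_affine[of "\<lambda>n. 3" "\<lambda>n. 1::real" k "\<lambda>n. f" "\<lambda>n. {0..}" "\<lambda>n. 0", OF moderate_const _ that] by simp
  show "tame \<Lambda> S k (\<lambda>n. rise (\<kappa> n) (D n))"
    by (rule tame_support[where S = "\<lambda>n. {0..}"], simp, unfold rise_def)
      (intro tame_mult aff tame_step ex, simp add: step_eq_0)
  show "tame \<Lambda> S k (\<lambda>n. rise_rate (\<kappa> n) (D n))"
    by (rule tame_support[where S = "\<lambda>n. {0..}"], simp, unfold rise_rate_def)
      (intro tame_mult tame_const moderate_const aff tame_deriv tame_step ex, simp add: deriv_step_eq_0)
qed

lemma (in growth_scale) tame_absorb:
  assumes W: "\<And>n. 0 \<le> W n" "\<And>n. W n \<le> 1/2"
    and \<rho>: "\<And>n p. \<bar>\<rho> n p\<bar> \<le> 1" "tame \<Lambda> S k \<rho>" and \<sigma>: "tame \<Lambda> S k \<sigma>"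
    and trig: "tame \<Lambda> S k (\<lambda>n p. cos (\<phi> n p))" "tame \<Lambda> S k (\<lambda>n p. cos (\<theta> n p))" "tame \<Lambda> S k (\<lambda>n p. sin (\<theta> n p))"
  shows "tame \<Lambda> S k (\<lambda>n p. absorb_c (W n) (\<rho> n p) (\<sigma> n p) (\<phi> n p) (\<theta> n p))"
    and "tame \<Lambda> S k (\<lambda>n p. absorb_b (W n) (\<rho> n p) (\<sigma> n p) (\<phi> n p) (\<theta> n p))"
proof -
  have "moderate \<Lambda> W" using W by (intro moderate_le[OF moderate_const[of _ 1]]) (smt (verit) field_sum_of_halves)
  moreover have "1/2 \<le> 1 + W n * \<rho> n p * (cos (\<phi> n p) * cos (\<theta> n p))" for n p
    by (intro absorb_denominator W \<rho>)
  ultimately have "tame \<Lambda> S k (\<lambda>n p. inverse (1 + W n * \<rho> n p * (cos (\<phi> n p) * cos (\<theta> n p))))"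
    using \<rho>(2)
    by (intro tame_inverse[of "1/2"] tame_add tame_mult tame_const moderate_const trig) auto
  then show "tame \<Lambda> S k (\<lambda>n p. absorb_c (W n) (\<rho> n p) (\<sigma> n p) (\<phi> n p) (\<theta> n p))"
    "tame \<Lambda> S k (\<lambda>n p. absorb_b (W n) (\<rho> n p) (\<sigma> n p) (\<phi> n p) (\<theta> n p))"
    unfolding absorb_c_def absorb_b_def by (intro tame_minus tame_mult \<sigma> trig; assumption)+
qed

section \<open>The cascade of frequencies\<close>

text \<open>
  The constant \<open>B\<close> bounds the slope and the Lipschitz constant of the derivative of the step.  The bound on the
  initial scale \<open>y0\<close> makes the gain of every window large enough for \<open>W n \<le> 1/2\<close> below.
\<close>
locale cascade = modulus \<mu> for \<mu> :: "real \<Rightarrow> real" +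
  fixes B y0 :: real and m :: nat
  assumes not_osgood: "\<not> osgood \<mu>" and m: "m > 0"
    and B: "B \<ge> 1" "\<And>x. \<bar>deriv step x\<bar> \<le> B" "\<And>x x'. \<bar>deriv step x - deriv step x'\<bar> \<le> B * \<bar>x - x'\<bar>"
    and y0: "0 < y0" "y0 \<le> 1" "y0 \<le> \<mu> 1 / (24 * B)"
begin

text \<open>
  Window \<open>n\<close> is \<open>[T n, T (n + 1)]\<close>, of length \<open>r n\<close>.  Wave \<open>n\<close> has damping rate \<open>Z n\<close>; it is switched on in
  window \<open>n\<close> and off in window \<open>n + 1\<close>, where wave \<open>n + 1\<close> takes over.  Window \<open>0\<close> carries no hand-over:
  its length \<open>3/2\<close> ensures that wave \<open>0\<close> is fully switched on at time \<open>0\<close>.  The number \<open>\<delta> n\<close> is the size of the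
  oscillation of \<open>l\<close> in window \<open>n\<close>.

  The logarithm of the quotient of wave \<open>n + 1\<close> by wave \<open>n\<close> runs through window \<open>n + 1\<close> as follows
  (lemma \<open>ratio_exponent\<close>).  It starts at \<open>- P n / 2\<close>, gains \<open>K n \<ge> P n\<close> from the oscillation of \<open>l\<close>, and loses
  \<open>D n \<le> P n / 4\<close> because wave \<open>n + 1\<close> has the higher frequency, so that it ends above \<open>P n / 4\<close>.
  The starting value is fixed through the initial amplitudes \<open>exp (- q n)\<close> of the waves.
\<close>
definition c0 :: real where "c0 = 1 / (6 * B)"
definition y :: "nat \<Rightarrow> real" where "y = scales \<mu> (c0 / 28) y0"
definition \<delta> :: "nat \<Rightarrow> real" where "\<delta> n = (case n of 0 \<Rightarrow> 0 | Suc k \<Rightarrow> c0 * \<mu> (y k))"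
definition r :: "nat \<Rightarrow> real" where "r n = (case n of 0 \<Rightarrow> 3/2 | Suc k \<Rightarrow> y k)"
definition T :: "nat \<Rightarrow> real" where "T n = 1 - suminf y - 3/2 + (\<Sum>i<n. r i)"
definition Z :: "nat \<Rightarrow> real" where "Z n = 1 / y n ^ 3"
definition z :: "nat \<Rightarrow> real" where "z n = root (2 * m) (Z n)"
definition od :: "nat \<Rightarrow> real" where "od n = (if odd n then 1 else 0)"
definition dir :: "nat \<Rightarrow> 2" where "dir n = (if odd n then 2 else 1)"
definition P :: "nat \<Rightarrow> real" where "P n = Z n * \<delta> (Suc n) * r (Suc n)"
definition D :: "nat \<Rightarrow> real" where "D n = (Z (Suc n) - Z n) * r (Suc n)"
definition K :: "nat \<Rightarrow> real" where
  "K n = \<delta> (Suc n) * r (Suc n) * (od n * Z n + od (Suc n) * Z (Suc n))"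
primrec q :: "nat \<Rightarrow> real" where
  "q 0 = \<mu> 1 / (24 * B) / y 0"
| "q (Suc n) = q n + Z n * r n - od n * Z n * \<delta> n * r n + P n / 2"

lemma r_0 [simp]: "r 0 = 3/2" and r_Suc [simp]: "r (Suc n) = y n"
  and \<delta>_0 [simp]: "\<delta> 0 = 0" and \<delta>_Suc [simp]: "\<delta> (Suc n) = c0 * \<mu> (y n)"
  by (simp_all add: r_def \<delta>_def)

lemma c0: "0 < c0" "c0 \<le> 1/6" "3 * B * c0 = 1/2"
  using B(1) by (auto simp: c0_def field_simps)

lemma y_pos: "0 < y n" and y_le: "y n \<le> y0" and y_Suc_le: "y (Suc n) \<le> y n"
  using scales_bounds[OF y0(1,2), of "c0/28" n] c0 by (auto simp: y_def)

lemma y_le_1: "y n \<le> 1" using y_le y0(2) by (rule order_trans)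

lemma y_nonneg [simp]: "0 \<le> y n" using y_pos by (rule less_imp_le)

lemma summable_y: "summable y"
  unfolding y_def using not_osgood y0 c0 by (intro summable_scales) auto

lemma mu_y: "0 < \<mu> (y n)" "\<mu> (y n) \<le> 1"
  using pos[OF y_pos y_le_1] le_1[OF _ y_le_1] by auto

lemma \<delta>_bounds: "0 \<le> \<delta> n" "\<delta> n \<le> c0"
  using c0 mu_y by (cases n; auto simp: less_imp_le mult_le_cancel_left2)+

lemma r_pos: "0 < r n" using y_pos by (cases n) auto

lemma T_Suc: "T (Suc n) = T n + r n" by (simp add: T_def)

lemma T_less: "n < k \<Longrightarrow> T n < T k"
  using lift_Suc_mono_less[of T] T_Suc r_pos by (metis less_add_same_cancel1)

lemma T_le: "n \<le> k \<Longrightarrow> T n \<le> T k"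
  using T_less[of n k] by (cases "n = k") auto

lemma T_Suc_eq: "T (Suc n) = 1 - suminf y + (\<Sum>i<n. y i)"
  unfolding T_def by (simp add: sum.lessThan_Suc_shift del: sum.lessThan_Suc)

lemma T_lim: "T \<longlonglongrightarrow> 1"
proof -
  have "(\<lambda>n. 1 - suminf y + (\<Sum>i<n. y i)) \<longlonglongrightarrow> 1 - suminf y + suminf y"
    by (intro tendsto_intros summable_LIMSEQ summable_y)
  then have "(\<lambda>n. T (Suc n)) \<longlonglongrightarrow> 1" by (simp add: T_Suc_eq)
  then show ?thesis by (simp add: filterlim_sequentially_Suc)
qed

lemma T_less_1: "T n < 1"
proof -
  have "T (Suc n) \<le> 1"
    using T_lim T_le by (intro LIMSEQ_le_const[of T]) auto
  then show ?thesis using T_less[of n "Suc n"] by simp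
qed

lemma T_0: "T 0 + r 0 / 3 \<le> 0"
  using T_less_1[of "Suc 0"] T_Suc[of 0] by simp

definition \<Lambda> :: "nat \<Rightarrow> real" where "\<Lambda> n = 1 / y n"

lemma Z_\<Lambda>: "Z n = \<Lambda> n ^ 3" by (simp add: Z_def \<Lambda>_def power_one_over)

lemma \<Lambda>_ge_1: "\<Lambda> n \<ge> 1" using y_pos[of n] y_le_1[of n] by (simp add: \<Lambda>_def)

sublocale growth_scale \<Lambda> by standard (rule \<Lambda>_ge_1)

lemma Z_ge_1: "Z n \<ge> 1" unfolding Z_\<Lambda> using \<Lambda>_ge_1 by simp

lemma ratio: "\<Lambda> (Suc n) = \<Lambda> n * (1 + c0 / 28 * \<mu> (y n))"
  by (simp add: \<Lambda>_def y_def)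

text \<open>
  The factor \<open>1/28\<close> in the recursion for the scales is chosen here: the cube of \<open>1 + e\<close> is at most
  \<open>1 + 7 e\<close>, and \<open>7 / 28 = 1 / 4\<close>.
\<close>
lemma Z_increment: "Z n \<le> Z (Suc n)" "Z (Suc n) - Z n \<le> Z n * \<delta> (Suc n) / 4" "Z (Suc n) \<le> 2 * Z n"
proof -
  define e where "e = c0 / 28 * \<mu> (y n)"
  have e: "0 \<le> e" "e \<le> 1" using c0 mu_y[of n] mult_mono[of "c0/28" 1 "\<mu> (y n)" 1] by (auto simp: e_def)
  have eq: "Z (Suc n) = Z n * (1 + e) ^ 3" by (simp add: Z_\<Lambda> ratio e_def power_mult_distrib)
  have "e * e \<le> e" "e * (e * e) \<le> e" using e by (simp_all add: mult_le_one mult_left_le)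
  then have "(1 + e) ^ 3 \<le> 1 + 7 * e" by (simp add: power3_eq_cube algebra_simps)
  then have "Z (Suc n) \<le> Z n * (1 + 7 * e)"
    unfolding eq using Z_ge_1[of n] by (intro mult_left_mono) auto
  then show "Z (Suc n) - Z n \<le> Z n * \<delta> (Suc n) / 4"
    by (simp add: e_def algebra_simps)
  also have "\<dots> \<le> Z n * 1"
    unfolding times_divide_eq_right[symmetric] using Z_ge_1[of n] \<delta>_bounds(2)[of "Suc n"] c0(2) by (intro mult_left_mono) auto
  finally show "Z (Suc n) \<le> 2 * Z n" by simp
  have "1 \<le> (1 + e) ^ 3" using e by simp
  then show "Z n \<le> Z (Suc n)" unfolding eq using Z_ge_1[of n] by (simp add: mult_le_cancel_left1)
qed

text \<open>
  By concavity \<open>\<mu>(y) \<ge> y \<mu>(1)\<close>, so \<open>P n = c0 \<mu>(y\<^sub>n) / y\<^sub>n\<^sup>2\<close> is at least of order \<open>1 / y\<^sub>n\<close>.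
\<close>
lemma P_ge: "P n / 4 \<ge> \<mu> 1 / (24 * B) / y n" "P n / 4 \<ge> 1"
proof -
  have "\<mu> 1 * y n \<le> \<mu> (y n)" using ge_linear[of "y n"] y_le_1[of n] by (simp add: mult.commute)
  then have "c0 * (\<mu> 1 * y n) / y n ^ 2 \<le> c0 * \<mu> (y n) / y n ^ 2"
    using c0 by (intro divide_right_mono mult_left_mono) auto
  also have "\<dots> = P n" using y_pos[of n] by (simp add: P_def Z_def power3_eq_cube power2_eq_square)
  finally show *: "P n / 4 \<ge> \<mu> 1 / (24 * B) / y n"
    using y_pos[of n] B(1) by (simp add: c0_def power2_eq_square field_simps)
  have "y n \<le> \<mu> 1 / (24 * B)" using y_le y0(3) by (rule order_trans)
  then have "1 \<le> \<mu> 1 / (24 * B) / y n"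
    by (subst pos_le_divide_eq[OF y_pos]) simp
  then show "P n / 4 \<ge> 1" using * by simp
qed

lemma D_bounds: "0 \<le> D n" "D n \<le> P n / 4"
  using Z_increment[of n] y_pos[of n] mult_right_mono[of "Z (Suc n) - Z n" "Z n * \<delta> (Suc n) / 4" "y n"]
  by (auto simp: D_def P_def)

lemma K_ge_P: "K n \<ge> P n"
proof -
  have "od n * Z n + od (Suc n) * Z (Suc n) \<ge> Z n" using Z_increment(1)[of n] by (simp add: od_def)
  then have "\<delta> (Suc n) * r (Suc n) * Z n \<le> K n"
    unfolding K_def using \<delta>_bounds(1)[of "Suc n"] r_pos[of "Suc n"] by (intro mult_left_mono mult_nonneg_nonneg) auto
  then show ?thesis by (simp add: P_def mult_ac)
qed

text \<open>
  The summand \<open>P n / 2\<close> in the recursion gives the bound at once, because consecutive scales differ by a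
  factor of at most two.
\<close>
lemma q_ge: "q n \<ge> \<mu> 1 / (24 * B) / y n"
proof -
  have a: "0 < \<mu> 1 / (24 * B)" using pos[of 1] B(1) by simp
  have inc: "Z n * r n - od n * Z n * \<delta> n * r n \<ge> 0" for n
  proof -
    have "od n * \<delta> n \<le> 1" using \<delta>_bounds(2)[of n] c0(2) by (auto simp: od_def)
    then have "(od n * \<delta> n) * (Z n * r n) \<le> 1 * (Z n * r n)"
      using Z_ge_1[of n] r_pos[of n] by (intro mult_right_mono) auto
    then show ?thesis by (simp add: mult_ac)
  qed
  have "q n \<ge> 0 \<and> q n \<ge> \<mu> 1 / (24 * B) / y n"
  proof (induction n)
    case 0 then show ?case using divide_pos_pos[OF a y_pos[of 0]] by simp
  next
    case (Suc n)
    have "1 / y (Suc n) \<le> 2 * (1 / y n)"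
    proof -
      have "1 + c0 / 28 * \<mu> (y n) \<le> 2"
        using c0 mu_y[of n] mult_mono[of "c0/28" 1 "\<mu> (y n)" 1] by auto
      then show ?thesis using ratio[of n] \<Lambda>_ge_1[of n] mult_left_mono[of _ 2 "\<Lambda> n"]
        by (simp add: \<Lambda>_def mult.commute)
    qed
    then have "\<mu> 1 / (24 * B) * (1 / y (Suc n)) \<le> \<mu> 1 / (24 * B) * (2 * (1 / y n))"
      using a by (intro mult_left_mono) auto
    also have "\<dots> \<le> P n / 2" using P_ge(1)[of n] by simp
    finally have "\<mu> 1 / (24 * B) / y (Suc n) \<le> P n / 2" by simp
    moreover have "P n \<ge> 0" using P_ge(2)[of n] by simp
    ultimately show ?case using Suc inc[of n] by (simp only: q.simps) linarith
  qed
  then show ?thesis by simp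
qed

lemma weight_summable: "summable (\<lambda>n. exp (- q n) * \<Lambda> n ^ k)" "summable (\<lambda>n. exp (- (P n / 4)) * \<Lambda> n ^ k)"
  unfolding \<Lambda>_def using pos[of 1] B(1)
  by (intro summable_exp_weight[OF summable_y y_pos _ q_ge] summable_exp_weight[OF summable_y y_pos _ P_ge(1)]; simp)+

lemma z_power: "z n ^ (2 * m) = Z n" and z_ge_1: "z n \<ge> 1" and z_le: "z n \<le> Z n"
proof -
  show 1: "z n ^ (2 * m) = Z n" unfolding z_def using m Z_ge_1[of n] by (intro real_root_pow_pos2) auto
  show 2: "z n \<ge> 1" unfolding z_def using m Z_ge_1[of n] by (subst real_root_ge_1_iff) auto
  show "z n \<le> Z n" unfolding 1[symmetric] using self_le_power[OF 2, of "2 * m"] m by simp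
qed

lemma moderate_Z: "moderate \<Lambda> Z"
  using moderate_power[of \<Lambda> 1 3] \<Lambda>_ge_1 by (simp add: Z_\<Lambda>[abs_def] order_trans[OF zero_le_one])

lemma moderate_Z_Suc: "moderate \<Lambda> (\<lambda>n. Z (Suc n))"
proof (rule moderate_le[OF moderate_mult[OF moderate_const[of _ 2] moderate_Z]])
  fix n show "\<bar>Z (Suc n)\<bar> \<le> \<bar>2 * Z n\<bar>" using Z_increment(3)[of n] Z_ge_1[of n] Z_ge_1[of "Suc n"] by simp
qed

lemma moderate_z: "moderate \<Lambda> z" "moderate \<Lambda> (\<lambda>n. z (Suc n))"
  by (rule moderate_le[OF moderate_Z], use z_le z_ge_1 in \<open>smt (verit)\<close>)
    (rule moderate_le[OF moderate_Z_Suc], use z_le z_ge_1 in \<open>smt (verit)\<close>)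

lemma moderate_inverse_z: "moderate \<Lambda> (\<lambda>n. 1 / z n)" "moderate \<Lambda> (\<lambda>n. 1 / z (Suc n))"
proof -
  have "\<bar>1 / z n\<bar> \<le> \<bar>1\<bar>" for n using z_ge_1[of n] by simp
  then show "moderate \<Lambda> (\<lambda>n. 1 / z n)" "moderate \<Lambda> (\<lambda>n. 1 / z (Suc n))"
    by (auto intro: moderate_le[OF moderate_const[of _ 1]])
qed

lemma moderate_inverse_r: "moderate \<Lambda> (\<lambda>n. 1 / r n)" "moderate \<Lambda> (\<lambda>n. 1 / r (Suc n))"
proof -
  have "moderate \<Lambda> \<Lambda>" using moderate_power[of \<Lambda> 1 1] \<Lambda>_ge_1 by (simp add: order_trans[OF zero_le_one])
  moreover have "\<bar>1 / r n\<bar> \<le> \<bar>\<Lambda> n\<bar>" for n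
  proof (cases n)
    case 0 then show ?thesis using \<Lambda>_ge_1[of 0] by simp
  next
    case (Suc k)
    then show ?thesis using y_pos[of k] y_pos[of n] y_Suc_le[of k] by (simp add: \<Lambda>_def frac_le)
  qed
  ultimately show "moderate \<Lambda> (\<lambda>n. 1 / r n)" by (rule moderate_le)
  show "moderate \<Lambda> (\<lambda>n. 1 / r (Suc n))" using \<open>moderate \<Lambda> \<Lambda>\<close> by (simp add: \<Lambda>_def[abs_def])
qed

lemma moderate_\<delta>: "moderate \<Lambda> \<delta>" "moderate \<Lambda> (\<lambda>n. \<delta> (Suc n))"
  by (rule moderate_le[OF moderate_const[of _ c0]], use \<delta>_bounds c0 in \<open>smt (verit)\<close>)+

lemma moderate_od: "moderate \<Lambda> od"
  by (rule moderate_le[OF moderate_const[of _ 1]]) (auto simp: od_def)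

lemma moderate_D: "moderate \<Lambda> D"
proof (rule moderate_le[OF moderate_Z])
  fix n
  have "\<delta> (Suc n) * r (Suc n) \<le> 1"
    using \<delta>_bounds[of "Suc n"] c0 y_le_1[of n] by (intro mult_le_one) (auto simp del: \<delta>_Suc)
  then have "Z n * (\<delta> (Suc n) * r (Suc n) / 4) \<le> Z n * 1"
    using Z_ge_1[of n] by (intro mult_left_mono) auto
  moreover have "P n / 4 = Z n * (\<delta> (Suc n) * r (Suc n) / 4)" by (simp add: P_def)
  ultimately show "\<bar>D n\<bar> \<le> \<bar>Z n\<bar>" using D_bounds[of n] Z_ge_1[of n] by linarith
qed

end

section \<open>Plane waves\<close>

lemma (in growth_scale) tame_time:
  assumes "moderate \<Lambda> a" "tame \<Lambda> (\<lambda>n. UNIV) k F"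
  shows "tame \<Lambda> S k (\<lambda>n (p :: real \<times> (real^2)). F n (a n * fst p + c n))"
  using tame_affine[OF assms(1) _ assms(2), of "\<lambda>n. (1, 0) :: real \<times> (real^2)"]
  by (simp add: inner_prod_def norm_Pair)

lemma (in growth_scale) tame_space:
  assumes "moderate \<Lambda> a" "tame \<Lambda> (\<lambda>n. UNIV) k F"
  shows "tame \<Lambda> S k (\<lambda>n (p :: real \<times> (real^2)). F n (a n * snd p $ j n + c n))"
  using tame_affine[OF assms(1) _ assms(2), of "\<lambda>n. (0, axis (j n) 1) :: real \<times> (real^2)"]
  by (simp add: inner_prod_def norm_Pair inner_axis)

lemma (in growth_scale) tame_cos_sin_space:
  assumes "moderate \<Lambda> a"
  shows "tame \<Lambda> S k (\<lambda>n (p :: real \<times> (real^2)). cos (a n * snd p $ j n))"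
    and "tame \<Lambda> S k (\<lambda>n (p :: real \<times> (real^2)). sin (a n * snd p $ j n))"
proof -
  show "tame \<Lambda> S k (\<lambda>n (p :: real \<times> (real^2)). cos (a n * snd p $ j n))"
    using tame_space[OF assms tame_cos_shift[of _ k 0], where c = "\<lambda>n. 0"] by simp
  have "cos (x - pi/2) = sin x" for x :: real by (simp add: cos_diff)
  then show "tame \<Lambda> S k (\<lambda>n (p :: real \<times> (real^2)). sin (a n * snd p $ j n))"
    using tame_space[OF assms tame_cos_shift[of _ k "- (pi/2)"], where c = "\<lambda>n. 0"] by simp
qed

lemma has_derivative_wave:
  fixes p :: "real \<times> (real^2)"
  assumes "(f has_real_derivative f') (at (fst p))"
  shows "((\<lambda>p. f (fst p) * cos (w * snd p $ j + c)) has_derivative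
     (\<lambda>h. f' * fst h * cos (w * snd p $ j + c) - f (fst p) * (w * snd h $ j) * sin (w * snd p $ j + c))) (at p)"
proof -
  have "(f has_derivative (\<lambda>h. f' * h)) (at (fst p))"
    using assms by (simp add: has_field_derivative_def)
  from has_derivative_compose[OF has_derivative_fst[OF has_derivative_ident] this]
  have 1: "((\<lambda>p::real \<times> (real^2). f (fst p)) has_derivative (\<lambda>h. f' * fst h)) (at p)" .
  have "bounded_linear (\<lambda>p::real \<times> (real^2). snd p $ j)"
    using bounded_linear_compose[OF bounded_linear_vec_nth bounded_linear_snd] .
  then have 2: "((\<lambda>p::real \<times> (real^2). snd p $ j) has_derivative (\<lambda>h. snd h $ j)) (at p)"
    by (rule bounded_linear_imp_has_derivative)
  show ?thesis by (auto intro!: derivative_eq_intros 1 2)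
qed

lemma iter_deriv_wave_time:
  assumes "(f has_real_derivative f') (at (fst p))"
  shows "iter_deriv UNIV [(1, 0)] (\<lambda>p::real \<times> (real^2). f (fst p) * cos (w * snd p $ j)) p = f' * cos (w * snd p $ j)"
  using frechet_derivative_at[OF has_derivative_wave[OF assms, of w j 0], symmetric] by simp

text \<open>
  Each derivative along the wave multiplies by the frequency and shifts the phase by \<open>\<pi>/2\<close>.
\<close>
lemma iter_deriv_wave_space:
  fixes f :: "real \<Rightarrow> real"
  assumes f: "\<And>t. (f has_real_derivative f' t) (at t)"
  shows "iter_deriv UNIV (replicate k (0, axis i 1)) (\<lambda>p::real \<times> (real^2). f (fst p) * cos (w * snd p $ j)) =
    (\<lambda>p. if k > 0 \<and> i \<noteq> j then 0 else w ^ k * (f (fst p) * cos (w * snd p $ j + k * (pi/2))))"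
proof (induction k)
  case (Suc k)
  show ?case
  proof
    fix p :: "real \<times> (real^2)"
    let ?G = "\<lambda>p::real \<times> (real^2). w ^ k * (f (fst p) * cos (w * snd p $ j + k * (pi/2)))"
    have d: "(?G has_derivative (\<lambda>h. w ^ k * (f' (fst p) * fst h * cos (w * snd p $ j + k * (pi/2))
       - f (fst p) * (w * snd h $ j) * sin (w * snd p $ j + k * (pi/2))))) (at p)"
      by (intro has_derivative_mult_right has_derivative_wave f)
    have G: "frechet_derivative ?G (at p) (0, axis i 1) =
        - (w ^ k * (f (fst p) * (w * axis i 1 $ j) * sin (w * snd p $ j + k * (pi/2))))"
      using frechet_derivative_at[OF d, symmetric] by simp
    have s: "cos (w * snd p $ j + (1 + real k) * pi / 2) = - sin (w * snd p $ j + real k * pi / 2)"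
      using minus_sin_cos_eq[of "w * snd p $ j + k * pi / 2"] by (simp add: algebra_simps add_divide_distrib)
    show "iter_deriv UNIV (replicate (Suc k) (0, axis i 1)) (\<lambda>p. f (fst p) * cos (w * snd p $ j)) p =
       (if Suc k > 0 \<and> i \<noteq> j then 0 else w ^ Suc k * (f (fst p) * cos (w * snd p $ j + Suc k * (pi/2))))"
    proof (cases "i = j")
      case True
      have "iter_deriv UNIV (replicate (Suc k) (0, axis i 1)) (\<lambda>p. f (fst p) * cos (w * snd p $ j)) p
         = frechet_derivative ?G (at p) (0, axis i 1)"
        using Suc unfolding True by simp
      then show ?thesis unfolding G using True s by (simp add: axis_def)
    next
      case False
      show ?thesis
      proof (cases "k = 0")
        case True
        then show ?thesis using False G by (simp add: axis_def)
      next
        case k: False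
        have "frechet_derivative (\<lambda>p::real \<times> (real^2). 0::real) (at p) = (\<lambda>h. 0)"
          using frechet_derivative_at[of "\<lambda>p. 0" "\<lambda>h. 0"] by simp
        then show ?thesis using False k by (simp add: Suc)
      qed
    qed
  qed
qed simp

context cascade begin

text \<open>
  The amplitude of wave \<open>n\<close> is \<open>cut n t * exp (- q n - E n t)\<close>.  The exponent \<open>E n\<close> is the damping accumulated
  since \<open>T n\<close>.  For odd \<open>n\<close> it contains the integral of the oscillation of \<open>l\<close> over the two windows
  in which the wave lives, first downwards and then upwards; the rise of \<open>J\<close> occupies the middle third of
  a window, the switching of the waves its outer thirds.
\<close>
definition \<tau> :: "nat \<Rightarrow> real \<Rightarrow> real" where "\<tau> n t = (t - T n) / r n"
definition J :: "real \<Rightarrow> real" where "J x = step (3 * x - 1)"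
definition E :: "nat \<Rightarrow> real \<Rightarrow> real" where
  "E n t = Z n * (t - T n) + od n * Z n *
     (\<delta> (Suc n) * r (Suc n) * J (\<tau> (Suc n) t) - \<delta> n * r n * J (\<tau> n t))"
definition E' :: "nat \<Rightarrow> real \<Rightarrow> real" where
  "E' n t = Z n + od n * Z n *
     (\<delta> (Suc n) * (3 * deriv step (3 * \<tau> (Suc n) t - 1)) - \<delta> n * (3 * deriv step (3 * \<tau> n t - 1)))"
definition cut :: "nat \<Rightarrow> real \<Rightarrow> real" where
  "cut n t = step (3 * \<tau> n t) * step (3 * (1 - \<tau> (Suc n) t))"
definition cut' :: "nat \<Rightarrow> real \<Rightarrow> real" where
  "cut' n t = 3 / r n * deriv step (3 * \<tau> n t) * step (3 * (1 - \<tau> (Suc n) t))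
     - 3 / r (Suc n) * deriv step (3 * (1 - \<tau> (Suc n) t)) * step (3 * \<tau> n t)"
definition amp :: "nat \<Rightarrow> real \<Rightarrow> real" where "amp n t = cut n t * exp (- E n t)"
definition amp' :: "nat \<Rightarrow> real \<Rightarrow> real" where
  "amp' n t = (cut' n t - cut n t * E' n t) * exp (- E n t)"
definition \<omega> :: "nat \<Rightarrow> real" where "\<omega> n = exp (- q n)"
definition \<theta> :: "nat \<Rightarrow> real \<times> (real^2) \<Rightarrow> real" where "\<theta> n p = z n * snd p $ dir n"
definition u :: "real \<times> (real^2) \<Rightarrow> real" where
  "u p = (\<Sum>n. \<omega> n * (amp n (fst p) * cos (z n * snd p $ dir n)))"

lemma \<tau>_affine: "a * \<tau> n t + b = a / r n * t + (b - a * T n / r n)"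
  by (simp add: \<tau>_def diff_divide_distrib algebra_simps)

lemma DERIV_step_\<tau>: "((\<lambda>t. step (a * \<tau> n t + b)) has_real_derivative a / r n * deriv step (a * \<tau> n t + b)) (at t)"
proof -
  have "((\<lambda>t. a * \<tau> n t + b) has_real_derivative a / r n) (at t)"
    unfolding \<tau>_def using r_pos[of n] by (auto intro!: derivative_eq_intros)
  from DERIV_chain2[OF DERIV_step this] show ?thesis by (simp add: mult.commute)
qed

lemma DERIV_E: "(E n has_real_derivative E' n t) (at t)"
proof -
  have J: "((\<lambda>t. c * r k * J (\<tau> k t)) has_real_derivative c * (3 * deriv step (3 * \<tau> k t - 1))) (at t)" for c k
    using DERIV_cmult[OF DERIV_step_\<tau>[of 3 k "-1" t], of "c * r k"] r_pos[of k] by (simp add: J_def)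
  have "((\<lambda>t. Z n * (t - T n)) has_real_derivative Z n) (at t)"
    by (auto intro!: derivative_eq_intros)
  from DERIV_add[OF this DERIV_cmult[OF DERIV_diff[OF J[of "\<delta> (Suc n)" "Suc n"] J[of "\<delta> n" n]], of "od n * Z n"]]
  show ?thesis unfolding E_def[abs_def] E'_def .
qed

lemma DERIV_cut: "(cut n has_real_derivative cut' n t) (at t)"
proof -
  have "((\<lambda>t. step (3 * (1 - \<tau> k t))) has_real_derivative - (3 / r k) * deriv step (3 * (1 - \<tau> k t))) (at t)" for k
    using DERIV_step_\<tau>[of "-3" k 3 t] by (simp add: algebra_simps)
  from DERIV_mult[OF DERIV_step_\<tau>[of 3 n 0 t, simplified] this[of "Suc n"]]
  show ?thesis unfolding cut_def[abs_def] cut'_def by (simp add: mult_ac)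
qed

lemma DERIV_amp: "(amp n has_real_derivative amp' n t) (at t)"
  unfolding amp_def[abs_def] amp'_def
  by (auto intro!: derivative_eq_intros DERIV_cut DERIV_E simp: algebra_simps)

lemma \<tau>_nonpos: "t \<le> T n \<Longrightarrow> \<tau> n t \<le> 0"
  using r_pos[of n] by (simp add: \<tau>_def divide_le_0_iff)

lemma \<tau>_nonneg: "T n \<le> t \<Longrightarrow> 0 \<le> \<tau> n t"
  using r_pos[of n] by (simp add: \<tau>_def)

lemma \<tau>_ge_1: "T (Suc n) \<le> t \<Longrightarrow> 1 \<le> \<tau> n t"
  using r_pos[of n] T_Suc[of n] by (simp add: \<tau>_def)

lemma amp_eq_0:
  assumes "t \<le> T n \<or> T (Suc (Suc n)) \<le> t"
  shows "cut n t = 0" "cut' n t = 0" "amp n t = 0" "amp' n t = 0"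
proof -
  have "cut n t = 0 \<and> cut' n t = 0"
    using assms
  proof
    assume "t \<le> T n"
    then show ?thesis using \<tau>_nonpos[of t n] by (simp add: cut_def cut'_def step_eq_0 deriv_step_eq_0)
  next
    assume "T (Suc (Suc n)) \<le> t"
    then show ?thesis using \<tau>_ge_1[of "Suc n" t] by (simp add: cut_def cut'_def step_eq_0 deriv_step_eq_0)
  qed
  then show "cut n t = 0" "cut' n t = 0" "amp n t = 0" "amp' n t = 0"
    by (simp_all add: amp_def amp'_def)
qed

text \<open>
  The oscillation of \<open>l\<close> cannot undo the damping: in window \<open>n\<close> it saves at most \<open>3 \<delta> n\<close> times the elapsed
  time, and \<open>3 \<delta> n \<le> 1\<close>.
\<close>
lemma E_nonneg:
  assumes "T n \<le> t" shows "0 \<le> E n t"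
proof (cases "odd n")
  case False
  then show ?thesis using assms Z_ge_1[of n] by (simp add: E_def od_def)
next
  case True
  have "J (\<tau> n t) \<le> 3 * \<tau> n t"
  proof (cases "3 * \<tau> n t \<le> 1")
    case True
    then show ?thesis using \<tau>_nonneg[OF assms] by (simp add: J_def step_eq_0)
  next
    case False
    then show ?thesis using step_le_1[of "3 * \<tau> n t - 1"] by (simp add: J_def)
  qed
  then have "\<delta> n * r n * J (\<tau> n t) \<le> \<delta> n * r n * (3 * \<tau> n t)"
    using \<delta>_bounds(1)[of n] r_pos[of n] by (intro mult_left_mono) auto
  also have "\<dots> = (\<delta> n * 3) * (t - T n)" using r_pos[of n] by (simp add: \<tau>_def)
  also have "\<dots> \<le> 1 * (t - T n)" using \<delta>_bounds(2)[of n] c0 assms by (intro mult_right_mono) auto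
  finally have "\<delta> n * r n * J (\<tau> n t) \<le> t - T n" by simp
  moreover have "0 \<le> \<delta> (Suc n) * r (Suc n) * J (\<tau> (Suc n) t)"
    using \<delta>_bounds(1)[of "Suc n"] r_pos[of "Suc n"] step_nonneg
    by (intro mult_nonneg_nonneg) (auto simp: J_def)
  moreover have "E n t = Z n * ((t - T n) + (\<delta> (Suc n) * r (Suc n) * J (\<tau> (Suc n) t) - \<delta> n * r n * J (\<tau> n t)))"
    using True by (simp add: E_def od_def algebra_simps)
  ultimately show ?thesis using Z_ge_1[of n] by (auto intro!: mult_nonneg_nonneg)
qed

lemma tame_step_\<tau>:
  assumes "\<And>k. tame \<Lambda> (\<lambda>n. UNIV) k (\<lambda>n. f)"
  shows "tame \<Lambda> S k (\<lambda>n t. f (a * \<tau> n t + b))" "tame \<Lambda> S k (\<lambda>n t. f (a * \<tau> (Suc n) t + b))"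
proof -
  have m: "moderate \<Lambda> (\<lambda>n. a * (1 / r n))" "moderate \<Lambda> (\<lambda>n. a * (1 / r (Suc n)))"
    by (intro moderate_mult moderate_const moderate_inverse_r)+
  show "tame \<Lambda> S k (\<lambda>n t. f (a * \<tau> n t + b))"
    unfolding \<tau>_affine using tame_affine[OF m(1) _ assms, of "\<lambda>n. 1::real"] by simp
  show "tame \<Lambda> S k (\<lambda>n t. f (a * \<tau> (Suc n) t + b))"
    unfolding \<tau>_affine using tame_affine[OF m(2) _ assms, of "\<lambda>n. 1::real"] by simp
qed

lemma tame_amp: "tame \<Lambda> S k amp"
proof (rule tame_support[where S = "\<lambda>n. {T n..T (Suc (Suc n))}"])
  have step3: "tame \<Lambda> S k (\<lambda>n t. step (3 * \<tau> n t))" "tame \<Lambda> S k (\<lambda>n t. step (3 * (1 - \<tau> (Suc n) t)))" for S k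
    using tame_step_\<tau>(1)[OF tame_step, of S k 3 0] tame_step_\<tau>(2)[OF tame_step, of S k "-3" 3]
    by (simp_all add: algebra_simps)
  have J': "tame \<Lambda> S k (\<lambda>n t. deriv step (3 * \<tau> n t - 1))" "tame \<Lambda> S k (\<lambda>n t. deriv step (3 * \<tau> (Suc n) t - 1))" for S k
    using tame_step_\<tau>[OF tame_deriv[OF tame_step], of S k 3 "-1"] by simp_all
  have E': "tame \<Lambda> S k E'" for S k
    unfolding E'_def[abs_def]
    by (intro tame_add tame_diff tame_mult tame_const moderate_const moderate_Z moderate_od moderate_\<delta> J')
  have "tame \<Lambda> (\<lambda>n. {T n..T (Suc (Suc n))}) k (\<lambda>n t. exp (- E n t))"
  proof (rule tame_exp)
    show "- E n p \<le> 0" if "p \<in> {T n..T (Suc (Suc n))}" for n p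
      using that E_nonneg by simp
    show "((\<lambda>t. - E n t) has_derivative (\<lambda>h. - E' n p * h)) (at p)" for n p
      using DERIV_minus[OF DERIV_E, of n p] by (simp only: has_field_derivative_def)
    show "tame \<Lambda> (\<lambda>n. {T n..T (Suc (Suc n))}) k (\<lambda>n p. - E' n p * b)" for b
      by (intro tame_mult tame_minus E' tame_const moderate_const)
  qed
  then show "tame \<Lambda> (\<lambda>n. {T n..T (Suc (Suc n))}) k amp"
    unfolding amp_def[abs_def] cut_def by (intro tame_mult step3)
  show "amp n p = 0" if "p \<notin> {T n..T (Suc (Suc n))}" for n p
    using that by (intro amp_eq_0) auto
qed simp

lemma tame_wave: "tame \<Lambda> S k (\<lambda>n p. amp n (fst p) * cos (z n * snd p $ dir n))"
  using tame_time[OF moderate_const[of _ 1] tame_amp, of S k "\<lambda>n. 0"]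
  by (intro tame_mult tame_cos_sin_space moderate_z) simp

lemma convex_slab: "convex slab"
  unfolding slab_def by (intro convex_Times) auto

lemma \<omega>_summable: "summable (\<lambda>n. \<omega> n * \<Lambda> n ^ k)"
  unfolding \<omega>_def by (rule weight_summable)

lemma \<omega>_pos: "\<omega> n > 0" by (simp add: \<omega>_def)

lemmas wave_series = tame_series[OF tame_wave less_imp_le[OF \<omega>_pos] \<omega>_summable convex_slab axially_thick_slab]

lemma u_smooth: "u \<in> Cb_infinity slab"
  using wave_series(1) by (simp add: u_def[abs_def])

lemma dt_u:
  assumes "t \<in> {0..1}"
  shows "dt u (t, x) = (\<Sum>n. \<omega> n * (amp' n t * cos (z n * x $ dir n)))"
proof -
  have "dt u (t, x) = (\<Sum>n. \<omega> n * iter_deriv UNIV [(1, 0)] (\<lambda>p. amp n (fst p) * cos (z n * snd p $ dir n)) (t, x))"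
    unfolding dt_def u_def[abs_def] using assms
    by (intro wave_series(2)) (auto simp: slab_def Basis_prod_def)
  also have "\<dots> = (\<Sum>n. \<omega> n * (amp' n t * cos (z n * x $ dir n)))"
    using iter_deriv_wave_time[OF DERIV_amp] by simp
  finally show ?thesis .
qed

lemma dx_u:
  assumes "t \<in> {0..1}" "k > 0"
  shows "dx j k u (t, x) = (\<Sum>n. \<omega> n * (if dir n = j then z n ^ k * (amp n t * cos (z n * x $ dir n + k * (pi/2))) else 0))"
proof -
  have "dx j k u (t, x) = (\<Sum>n. \<omega> n * iter_deriv UNIV (replicate k (0, axis j 1)) (\<lambda>p. amp n (fst p) * cos (z n * snd p $ dir n)) (t, x))"
    unfolding dx_def u_def[abs_def] using assms
    by (intro wave_series(2)) (auto simp: slab_def Basis_prod_def Basis_vec_def)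
  also have "\<dots> = (\<Sum>n. \<omega> n * (if dir n = j then z n ^ k * (amp n t * cos (z n * x $ dir n + k * (pi/2))) else 0))"
    unfolding iter_deriv_wave_space[OF DERIV_amp] using assms(2) by (intro suminf_cong) auto
  finally show ?thesis .
qed

end

context cascade begin

section \<open>The oscillating coefficient\<close>

definition osc :: "nat \<Rightarrow> real \<Rightarrow> real" where
  "osc n t = (if odd n then -1 else 1) * \<delta> n * (3 * deriv step (3 * \<tau> n t - 1))"

definition l :: "real \<Rightarrow> real" where "l t = 1 + (\<Sum>n. osc n t)"

lemma osc_eq_0: "t \<le> T n \<or> T (Suc n) \<le> t \<Longrightarrow> osc n t = 0"
  using \<tau>_nonpos[of t n] \<tau>_ge_1[of n t] by (auto simp: osc_def deriv_step_eq_0)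

lemma osc_single: "\<exists>i. \<forall>n. n \<noteq> i \<longrightarrow> osc n t = 0"
proof (cases "\<forall>n. osc n t = 0")
  case False
  then obtain i where "osc i t \<noteq> 0" by blast
  then have i: "T i < t" "t < T (Suc i)" using osc_eq_0[of t i] by (meson not_le)+
  have "osc n t = 0" if "n \<noteq> i" for n
  proof (rule osc_eq_0)
    from that consider "Suc n \<le> i" | "Suc i \<le> n" by linarith
    then show "t \<le> T n \<or> T (Suc n) \<le> t"
      by cases (use i T_le[of "Suc n" i] T_le[of "Suc i" n] in auto)
  qed
  then show ?thesis by blast
qed auto

lemma l_sum:
  assumes "finite I" "\<And>n. n \<notin> I \<Longrightarrow> osc n t = 0"
  shows "l t = 1 + (\<Sum>n\<in>I. osc n t)"
  unfolding l_def using assms by (subst suminf_finite) auto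

lemma osc_bound: "\<bar>osc n t\<bar> \<le> 1/2"
proof -
  have "\<bar>osc n t\<bar> = \<delta> n * (3 * \<bar>deriv step (3 * \<tau> n t - 1)\<bar>)"
    using \<delta>_bounds(1)[of n] by (simp add: osc_def abs_mult)
  also have "\<dots> \<le> c0 * (3 * B)"
    using \<delta>_bounds[of n] B(1,2) c0(1) by (intro mult_mono) auto
  also have "\<dots> = 1/2" using c0(3) by (simp add: mult_ac)
  finally show ?thesis .
qed

lemma l_bounds: "1/2 \<le> l t" "l t \<le> 3/2"
proof -
  obtain i where "\<forall>n. n \<noteq> i \<longrightarrow> osc n t = 0" using osc_single by blast
  then have "l t = 1 + osc i t" using l_sum[of "{i}" t] by auto
  then show "1/2 \<le> l t" "l t \<le> 3/2" using osc_bound[of i t] by (auto simp: abs_le_iff)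
qed

text \<open>
  For times closer than the window length \<open>y\<close>, Lipschitz continuity gives a multiple of \<open>(d / y) \<mu>(y)\<close>, which
  concavity bounds by \<open>\<mu>(d)\<close>; for times further apart, the size \<open>\<mu>(y)\<close> of the oscillation suffices.
\<close>
lemma osc_modulus:
  assumes "\<bar>t - s\<bar> \<le> 1"
  shows "\<bar>osc n t - osc n s\<bar> \<le> 3/2 * \<mu> \<bar>t - s\<bar>"
proof (cases n)
  case 0
  then show ?thesis using nonneg[of "\<bar>t - s\<bar>"] assms by (simp add: osc_def)
next
  case (Suc k)
  define d where "d = \<bar>t - s\<bar>"
  define X where "X = \<bar>deriv step (3 * \<tau> n t - 1) - deriv step (3 * \<tau> n s - 1)\<bar>"
  have d: "0 \<le> d" "d \<le> 1" using assms by (auto simp: d_def)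
  have mu: "0 < \<mu> (y k)" using mu_y by blast
  have eq: "\<bar>osc n t - osc n s\<bar> = c0 * \<mu> (y k) * (3 * X)"
  proof -
    have "osc n t - osc n s = (if odd n then -1 else 1) * \<delta> n *
       (3 * (deriv step (3 * \<tau> n t - 1) - deriv step (3 * \<tau> n s - 1)))"
      by (simp add: osc_def algebra_simps)
    then show ?thesis using mu c0(1) by (simp add: abs_mult X_def Suc del: right_diff_distrib_numeral)
  qed
  have cB: "c0 * (3 * B) = 1/2" using c0(3) by (simp add: mult_ac)
  show ?thesis
  proof (cases "d \<le> y k")
    case True
    have "3 * \<tau> n t - 1 - (3 * \<tau> n s - 1) = 3 / y k * (t - s)"
      by (simp add: \<tau>_def Suc diff_divide_distrib algebra_simps)
    then have "\<bar>3 * \<tau> n t - 1 - (3 * \<tau> n s - 1)\<bar> = 3 * (d / y k)"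
      using y_pos[of k] by (simp only: abs_mult d_def) simp
    then have "X \<le> B * (3 * (d / y k))"
      using B(3)[of "3 * \<tau> n t - 1" "3 * \<tau> n s - 1"] unfolding X_def by (simp only:)
    then have "c0 * \<mu> (y k) * (3 * X) \<le> c0 * \<mu> (y k) * (3 * (B * (3 * (d / y k))))"
      using mu c0(1) by (intro mult_left_mono) auto
    also have "\<dots> = (c0 * (3 * B)) * (3 * (d / y k * \<mu> (y k)))" by (simp add: mult_ac)
    also have "\<dots> = 3/2 * (d / y k * \<mu> (y k))" unfolding cB by simp
    also have "\<dots> \<le> 3/2 * \<mu> d"
      using concave_ge_chord[OF concave zero d(1) True y_pos y_le_1] by simp
    finally show ?thesis using eq by (simp add: d_def)
  next
    case False
    have "X \<le> 2 * B" using B(2)[of "3 * \<tau> n t - 1"] B(2)[of "3 * \<tau> n s - 1"] by (simp add: X_def)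
    then have "c0 * \<mu> (y k) * (3 * X) \<le> c0 * \<mu> (y k) * (3 * (2 * B))"
      using mu c0(1) by (intro mult_left_mono) auto
    also have "\<dots> = (c0 * (3 * B)) * (2 * \<mu> (y k))" by (simp add: mult_ac)
    also have "\<dots> = \<mu> (y k)" unfolding cB by simp
    also have "\<dots> \<le> \<mu> d" using False d(2) by (intro mono) auto
    also have "\<dots> \<le> 3/2 * \<mu> d" using nonneg[OF d] by simp
    finally show ?thesis using eq by (simp add: d_def)
  qed
qed

text \<open>
  At each time at most one oscillation is active, so two terms account for the difference.
\<close>
lemma l_modulus:
  assumes "\<bar>t - s\<bar> \<le> 1"
  shows "\<bar>l t - l s\<bar> \<le> 3 * \<mu> \<bar>t - s\<bar>"
proof -
  obtain i j where ij: "\<forall>n. n \<noteq> i \<longrightarrow> osc n t = 0" "\<forall>n. n \<noteq> j \<longrightarrow> osc n s = 0"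
    using osc_single by metis
  have "l t - l s = (\<Sum>n\<in>{i, j}. osc n t - osc n s)"
    using l_sum[of "{i, j}" t] l_sum[of "{i, j}" s] ij by (auto simp: sum_subtractf)
  also have "\<bar>\<dots>\<bar> \<le> (\<Sum>n\<in>{i, j}. 3/2 * \<mu> \<bar>t - s\<bar>)"
    by (intro order_trans[OF sum_abs] sum_mono osc_modulus assms)
  also have "\<dots> \<le> 3 * \<mu> \<bar>t - s\<bar>"
    using nonneg[of "\<bar>t - s\<bar>"] assms by (cases "i = j") auto
  finally show ?thesis .
qed

lemma l_C_mod: "l \<in> C_mod \<mu> {0..1}"
  unfolding C_mod_def
proof (intro CollectI bdd_aboveI, clarify)
  fix t s :: real assume "0 < \<bar>t - s\<bar>" "\<bar>t - s\<bar> \<le> 1"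
  then show "norm (l t - l s) / \<mu> \<bar>t - s\<bar> \<le> 3"
    using l_modulus[of t s] pos[of "\<bar>t - s\<bar>"] by (simp add: divide_le_eq)
qed

text \<open>
  The exponents were designed for this: where wave \<open>n\<close> lives, it is damped exactly as the equation
  demands.
\<close>
lemma E'_eq:
  assumes "T n \<le> t" "t \<le> T (Suc (Suc n))"
  shows "E' n t = Z n * (if odd n then l t else 1)"
proof (cases "odd n")
  case True
  have "osc k t = 0" if "k \<notin> {n, Suc n}" for k
  proof (rule osc_eq_0)
    from that consider "Suc k \<le> n" | "Suc (Suc n) \<le> k" by force
    then show "t \<le> T k \<or> T (Suc k) \<le> t"
      by cases (use assms T_le[of "Suc k" n] T_le[of "Suc (Suc n)" k] in auto)
  qed
  then have "l t = 1 + (osc n t + osc (Suc n) t)" by (subst l_sum[of "{n, Suc n}"]) auto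
  moreover have "E' n t = Z n * (1 + (osc n t + osc (Suc n) t))"
    using True by (simp add: E'_def od_def osc_def algebra_simps)
  ultimately show ?thesis using True by simp
qed (simp add: E'_def od_def)

section \<open>The equation\<close>

definition res :: "nat \<Rightarrow> real \<Rightarrow> real" where "res n t = cut' n t * exp (- E n t)"

lemma amp'_res: "amp' n t + Z n * (if odd n then l t else 1) * amp n t = res n t"
proof (cases "T n \<le> t \<and> t \<le> T (Suc (Suc n))")
  case True
  then show ?thesis using E'_eq[of n t] by (simp add: amp_def amp'_def res_def algebra_simps)
next
  case False
  then have "t \<le> T n \<or> T (Suc (Suc n)) \<le> t" by linarith
  then show ?thesis by (simp add: amp_eq_0 res_def)
qed

text \<open>
  The series are finite sums at each single time, which settles the convergence questions when the terms
  of the equation are added up.  The principal part leaves only the residuals of the cutoffs.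
\<close>
lemma finite_sums:
  assumes t: "t \<in> {0..1}" and I: "finite I" "\<And>n. n \<notin> I \<Longrightarrow> t \<le> T n \<or> T (Suc (Suc n)) \<le> t"
  shows "u (t, x) = (\<Sum>n\<in>I. \<omega> n * (amp n t * cos (\<theta> n (t, x))))"
    and "dx j 1 u (t, x) = (\<Sum>n\<in>I. if dir n = j then - (\<omega> n * (z n * (amp n t * sin (\<theta> n (t, x))))) else 0)"
    and "dt u (t, x) + (-1) ^ m * (dx 1 (2 * m) u (t, x) + l t * dx 2 (2 * m) u (t, x))
           = (\<Sum>n\<in>I. \<omega> n * (res n t * cos (\<theta> n (t, x))))"
proof -
  have z: "amp n t = 0" "amp' n t = 0" if "n \<notin> I" for n using amp_eq_0 I(2)[OF that] by auto
  show "u (t, x) = (\<Sum>n\<in>I. \<omega> n * (amp n t * cos (\<theta> n (t, x))))"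
    unfolding u_def \<theta>_def using z I(1) by (subst suminf_finite) auto
  have dx: "dx j k u (t, x) = (\<Sum>n\<in>I. \<omega> n * (if dir n = j then z n ^ k * (amp n t * cos (\<theta> n (t, x) + k * (pi/2))) else 0))"
    if "k > 0" for j k
    unfolding dx_u[OF t that] \<theta>_def snd_conv using z I(1) by (subst suminf_finite) auto
  have s: "cos (v + pi/2) = - sin v" for v :: real by (simp add: cos_add)
  show "dx j 1 u (t, x) = (\<Sum>n\<in>I. if dir n = j then - (\<omega> n * (z n * (amp n t * sin (\<theta> n (t, x))))) else 0)"
    unfolding dx[OF zero_less_one] by (intro sum.cong) (simp_all add: s)
  have c: "cos (v + (2 * m) * (pi/2)) = (-1) ^ m * cos v" for v :: real
    by (simp add: cos_add)
  have dx2m: "(-1) ^ m * dx j (2 * m) u (t, x) = (\<Sum>n\<in>I. if dir n = j then \<omega> n * (Z n * (amp n t * cos (\<theta> n (t, x)))) else 0)" for j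
  proof -
    have sq: "(-1) ^ m * ((-1) ^ m * X) = X" for X :: real
      by (simp add: mult.assoc[symmetric] power_mult_distrib[symmetric])
    have "(-1) ^ m * (\<omega> n * (z n ^ (2 * m) * (amp n t * ((-1) ^ m * cos (\<theta> n (t, x))))))
       = \<omega> n * (Z n * (amp n t * cos (\<theta> n (t, x))))" for n
      using sq[of "\<omega> n * (Z n * (amp n t * cos (\<theta> n (t, x))))"] unfolding z_power by (simp only: mult_ac)
    then show ?thesis
      using m unfolding dx[of "2 * m" j, OF mult_pos_pos[OF zero_less_numeral m]] c sum_distrib_left
      by (intro sum.cong) auto
  qed
  have dt: "dt u (t, x) = (\<Sum>n\<in>I. \<omega> n * (amp' n t * cos (\<theta> n (t, x))))"
    unfolding dt_u[OF t] \<theta>_def using z I(1) by (subst suminf_finite) auto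
  have "dt u (t, x) + (-1) ^ m * (dx 1 (2 * m) u (t, x) + l t * dx 2 (2 * m) u (t, x))
     = dt u (t, x) + (-1) ^ m * dx 1 (2 * m) u (t, x) + l t * ((-1) ^ m * dx 2 (2 * m) u (t, x))"
    by (simp add: algebra_simps)
  also have "\<dots> = (\<Sum>n\<in>I. \<omega> n * ((amp' n t + Z n * (if odd n then l t else 1) * amp n t) * cos (\<theta> n (t, x))))"
    unfolding dx2m dt sum_distrib_left sum.distrib[symmetric]
    by (intro sum.cong) (auto simp: dir_def algebra_simps)
  also have "\<dots> = (\<Sum>n\<in>I. \<omega> n * (res n t * cos (\<theta> n (t, x))))" by (simp only: amp'_res)
  finally show "dt u (t, x) + (-1) ^ m * (dx 1 (2 * m) u (t, x) + l t * dx 2 (2 * m) u (t, x))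
           = (\<Sum>n\<in>I. \<omega> n * (res n t * cos (\<theta> n (t, x))))" .
qed

text \<open>
  In window \<open>n + 1\<close> two switchings take place.  Near its beginning wave \<open>n + 1\<close> is switched on (suffix \<open>on\<close>) in
  presence of wave \<open>n\<close>; near its end wave \<open>n\<close> is switched off (suffix \<open>off\<close>) in presence of wave \<open>n + 1\<close>.  With
  the time reversed, \<open>1 - \<tau>\<close> in place of \<open>\<tau>\<close>, the second is a switching on.  In both cases the small
  wave has the relative size \<open>W n * \<rho>\<close>; the factor \<open>W n\<close> is taken out because it is the common weight of the
  series for the coefficients.
\<close>
definition W :: "nat \<Rightarrow> real" where "W n = exp (- (P n / 4))"
definition \<kappa>_on :: "nat \<Rightarrow> real" where "\<kappa>_on n = P n / 4"
definition \<kappa>_off :: "nat \<Rightarrow> real" where "\<kappa>_off n = K n - D n - 3 * P n / 4"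
definition \<rho>_on :: "nat \<Rightarrow> real \<Rightarrow> real" where "\<rho>_on n t = rise (\<kappa>_on n) (D n) (\<tau> (Suc n) t)"
definition \<rho>_off :: "nat \<Rightarrow> real \<Rightarrow> real" where "\<rho>_off n t = rise (\<kappa>_off n) (D n) (1 - \<tau> (Suc n) t)"
definition \<sigma>_on :: "nat \<Rightarrow> real \<Rightarrow> real" where
  "\<sigma>_on n t = 1 / r (Suc n) * rise_rate (\<kappa>_on n) (D n) (\<tau> (Suc n) t)"
definition \<sigma>_off :: "nat \<Rightarrow> real \<Rightarrow> real" where
  "\<sigma>_off n t = - (1 / r (Suc n) * rise_rate (\<kappa>_off n) (D n) (1 - \<tau> (Suc n) t))"

definition c :: "real \<times> (real^2) \<Rightarrow> real" where
  "c p = (\<Sum>n. W n * (absorb_c (W n) (\<rho>_on n (fst p)) (\<sigma>_on n (fst p)) (\<theta> (Suc n) p) (\<theta> n p)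
                     + absorb_c (W n) (\<rho>_off n (fst p)) (\<sigma>_off n (fst p)) (\<theta> n p) (\<theta> (Suc n) p)))"
definition b :: "2 \<Rightarrow> real \<times> (real^2) \<Rightarrow> real" where
  "b j p = (\<Sum>n. W n *
     ((if dir n = j then 1 / z n else 0) * absorb_b (W n) (\<rho>_on n (fst p)) (\<sigma>_on n (fst p)) (\<theta> (Suc n) p) (\<theta> n p)
    + (if dir (Suc n) = j then 1 / z (Suc n) else 0) * absorb_b (W n) (\<rho>_off n (fst p)) (\<sigma>_off n (fst p)) (\<theta> n p) (\<theta> (Suc n) p)))"

lemma \<kappa>_nonneg: "0 \<le> \<kappa>_on n" "0 \<le> \<kappa>_off n"
  using P_ge(2)[of n] D_bounds[of n] K_ge_P[of n] by (auto simp: \<kappa>_on_def \<kappa>_off_def)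

lemma W_bounds: "0 < W n" "W n \<le> 1/2"
proof -
  show "0 < W n" by (simp add: W_def)
  have "W n \<le> exp (- 1)" using P_ge(2)[of n] by (simp add: W_def)
  also have "\<dots> \<le> 1/2" using exp_ge_add_one_self[of "1::real"] by (simp add: exp_minus field_simps)
  finally show "W n \<le> 1/2" .
qed

lemma \<rho>_bounds: "\<bar>\<rho>_on n t\<bar> \<le> 1" "\<bar>\<rho>_off n t\<bar> \<le> 1"
  using rise_bounds[OF \<kappa>_nonneg(1) D_bounds(1)] rise_bounds[OF \<kappa>_nonneg(2) D_bounds(1)]
  by (auto simp: \<rho>_on_def \<rho>_off_def)

text \<open>
  The waves and the coefficients depend on time through \<open>\<tau>\<close>, which is affine with the slope
  \<open>1 / r (n + 1)\<close>.
\<close>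
lemma tame_time_\<tau>:
  assumes F: "tame \<Lambda> (\<lambda>n. UNIV) k F"
  shows "tame \<Lambda> S k (\<lambda>n (p :: real \<times> (real^2)). F n (\<tau> (Suc n) (fst p)))"
    and "tame \<Lambda> S k (\<lambda>n (p :: real \<times> (real^2)). F n (1 - \<tau> (Suc n) (fst p)))"
proof -
  have 1: "1 / r (Suc n) * t + (- (T (Suc n) / r (Suc n))) = \<tau> (Suc n) t"
    "- 1 * (1 / r (Suc n)) * t + (1 + T (Suc n) / r (Suc n)) = 1 - \<tau> (Suc n) t" for n t
    by (simp_all add: \<tau>_def diff_divide_distrib)
  show "tame \<Lambda> S k (\<lambda>n (p :: real \<times> (real^2)). F n (\<tau> (Suc n) (fst p)))"
    using tame_time[OF moderate_inverse_r(2) F, of S "\<lambda>n. - (T (Suc n) / r (Suc n))"] unfolding 1 .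
  have "moderate \<Lambda> (\<lambda>n. - 1 * (1 / r (Suc n)))" by (intro moderate_mult moderate_const moderate_inverse_r)
  from tame_time[OF this F, of S "\<lambda>n. 1 + T (Suc n) / r (Suc n)"]
  show "tame \<Lambda> S k (\<lambda>n (p :: real \<times> (real^2)). F n (1 - \<tau> (Suc n) (fst p)))" unfolding 1 .
qed

lemma tame_corrections:
  shows "tame \<Lambda> S k (\<lambda>n p. absorb_c (W n) (\<rho>_on n (fst p)) (\<sigma>_on n (fst p)) (\<theta> (Suc n) p) (\<theta> n p))"
    and "tame \<Lambda> S k (\<lambda>n p. absorb_b (W n) (\<rho>_on n (fst p)) (\<sigma>_on n (fst p)) (\<theta> (Suc n) p) (\<theta> n p))"
    and "tame \<Lambda> S k (\<lambda>n p. absorb_c (W n) (\<rho>_off n (fst p)) (\<sigma>_off n (fst p)) (\<theta> n p) (\<theta> (Suc n) p))"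
    and "tame \<Lambda> S k (\<lambda>n p. absorb_b (W n) (\<rho>_off n (fst p)) (\<sigma>_off n (fst p)) (\<theta> n p) (\<theta> (Suc n) p))"
proof -
  note rise = tame_rise[OF \<kappa>_nonneg(1) D_bounds(1) moderate_D] tame_rise[OF \<kappa>_nonneg(2) D_bounds(1) moderate_D]
  have \<rho>: "tame \<Lambda> S k (\<lambda>n (p :: real \<times> (real^2)). \<rho>_on n (fst p))" "tame \<Lambda> S k (\<lambda>n (p :: real \<times> (real^2)). \<rho>_off n (fst p))"
    unfolding \<rho>_on_def \<rho>_off_def by (intro tame_time_\<tau> rise)+
  have \<sigma>: "tame \<Lambda> S k (\<lambda>n (p :: real \<times> (real^2)). \<sigma>_on n (fst p))" "tame \<Lambda> S k (\<lambda>n (p :: real \<times> (real^2)). \<sigma>_off n (fst p))"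
    unfolding \<sigma>_on_def \<sigma>_off_def by (intro tame_minus tame_cmult moderate_inverse_r tame_time_\<tau> rise)+
  have trig: "tame \<Lambda> S k (\<lambda>n p. cos (\<theta> n p))" "tame \<Lambda> S k (\<lambda>n p. sin (\<theta> n p))"
    "tame \<Lambda> S k (\<lambda>n p. cos (\<theta> (Suc n) p))" "tame \<Lambda> S k (\<lambda>n p. sin (\<theta> (Suc n) p))"
    unfolding \<theta>_def by (intro tame_cos_sin_space moderate_z)+
  note W = less_imp_le[OF W_bounds(1)] W_bounds(2)
  show "tame \<Lambda> S k (\<lambda>n p. absorb_c (W n) (\<rho>_on n (fst p)) (\<sigma>_on n (fst p)) (\<theta> (Suc n) p) (\<theta> n p))"
    "tame \<Lambda> S k (\<lambda>n p. absorb_b (W n) (\<rho>_on n (fst p)) (\<sigma>_on n (fst p)) (\<theta> (Suc n) p) (\<theta> n p))"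
    using tame_absorb[OF W \<rho>_bounds(1) \<rho>(1) \<sigma>(1) trig(3,1,2)] by auto
  show "tame \<Lambda> S k (\<lambda>n p. absorb_c (W n) (\<rho>_off n (fst p)) (\<sigma>_off n (fst p)) (\<theta> n p) (\<theta> (Suc n) p))"
    "tame \<Lambda> S k (\<lambda>n p. absorb_b (W n) (\<rho>_off n (fst p)) (\<sigma>_off n (fst p)) (\<theta> n p) (\<theta> (Suc n) p))"
    using tame_absorb[OF W \<rho>_bounds(2) \<rho>(2) \<sigma>(2) trig(1,3,4)] by auto
qed

lemma W_summable: "summable (\<lambda>n. W n * \<Lambda> n ^ k)"
  unfolding W_def by (rule weight_summable)

lemma c_smooth: "c \<in> Cb_infinity slab"
  unfolding c_def[abs_def]
  by (rule tame_series(1)[OF _ less_imp_le[OF W_bounds(1)] W_summable convex_slab axially_thick_slab])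
    (intro tame_add tame_corrections)

lemma b_smooth: "b j \<in> Cb_infinity slab"
proof -
  have m: "moderate \<Lambda> (\<lambda>n. if dir n = j then 1 / z n else 0)" "moderate \<Lambda> (\<lambda>n. if dir (Suc n) = j then 1 / z (Suc n) else 0)"
    by (rule moderate_le[OF moderate_inverse_z(1)], simp) (rule moderate_le[OF moderate_inverse_z(2)], simp)
  show ?thesis
    unfolding b_def[abs_def]
    by (rule tame_series(1)[OF _ less_imp_le[OF W_bounds(1)] W_summable convex_slab axially_thick_slab])
      (intro tame_add tame_cmult m tame_corrections)
qed

lemma \<sigma>_eq_0:
  assumes "t \<le> T (Suc n) \<or> T (Suc (Suc n)) \<le> t"
  shows "\<sigma>_on n t = 0" "\<sigma>_off n t = 0"
  using assms \<tau>_nonpos[of t "Suc n"] \<tau>_ge_1[of "Suc n" t]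
  by (auto simp: \<sigma>_on_def \<sigma>_off_def rise_rate_def deriv_step_eq_0)

lemma absorb_0: "absorb_c w s 0 f g = 0" "absorb_b w s 0 f g = 0"
  by (simp_all add: absorb_c_def absorb_b_def)

lemma coeff_sum:
  assumes "finite I" "\<And>n. n \<notin> I \<Longrightarrow> t \<le> T (Suc n) \<or> T (Suc (Suc n)) \<le> t"
  shows "c (t, x) = (\<Sum>n\<in>I. W n * (absorb_c (W n) (\<rho>_on n t) (\<sigma>_on n t) (\<theta> (Suc n) (t, x)) (\<theta> n (t, x))
                     + absorb_c (W n) (\<rho>_off n t) (\<sigma>_off n t) (\<theta> n (t, x)) (\<theta> (Suc n) (t, x))))"
    and "b j (t, x) = (\<Sum>n\<in>I. W n *
     ((if dir n = j then 1 / z n else 0) * absorb_b (W n) (\<rho>_on n t) (\<sigma>_on n t) (\<theta> (Suc n) (t, x)) (\<theta> n (t, x))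
    + (if dir (Suc n) = j then 1 / z (Suc n) else 0) * absorb_b (W n) (\<rho>_off n t) (\<sigma>_off n t) (\<theta> n (t, x)) (\<theta> (Suc n) (t, x))))"
proof -
  have z: "\<sigma>_on n t = 0" "\<sigma>_off n t = 0" if "n \<notin> I" for n using \<sigma>_eq_0 assms(2)[OF that] by auto
  show "c (t, x) = (\<Sum>n\<in>I. W n * (absorb_c (W n) (\<rho>_on n t) (\<sigma>_on n t) (\<theta> (Suc n) (t, x)) (\<theta> n (t, x))
                     + absorb_c (W n) (\<rho>_off n t) (\<sigma>_off n t) (\<theta> n (t, x)) (\<theta> (Suc n) (t, x))))"
    unfolding c_def fst_conv using z assms(1) by (subst suminf_finite[of I]) (auto simp: absorb_0)
  show "b j (t, x) = (\<Sum>n\<in>I. W n *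
     ((if dir n = j then 1 / z n else 0) * absorb_b (W n) (\<rho>_on n t) (\<sigma>_on n t) (\<theta> (Suc n) (t, x)) (\<theta> n (t, x))
    + (if dir (Suc n) = j then 1 / z (Suc n) else 0) * absorb_b (W n) (\<rho>_off n t) (\<sigma>_off n t) (\<theta> n (t, x)) (\<theta> (Suc n) (t, x))))"
    unfolding b_def fst_conv using z assms(1) by (subst suminf_finite[of I]) (auto simp: absorb_0)
qed

text \<open>
  In this window the oscillation of window \<open>n\<close> is over and that of window \<open>n + 2\<close> has not begun, so the
  corresponding values of \<open>J\<close> are \<open>1\<close> and \<open>0\<close>; the recursion for \<open>q\<close> cancels all constants but \<open>- P n / 2\<close>.
\<close>
lemma ratio_exponent:
  assumes "T (Suc n) \<le> t" "t \<le> T (Suc (Suc n))"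
  shows "q n + E n t - (q (Suc n) + E (Suc n) t) = - (P n / 2) - D n * \<tau> (Suc n) t + K n * J (\<tau> (Suc n) t)"
proof -
  have J1: "J (\<tau> n t) = 1" using \<tau>_ge_1[OF assms(1)] by (simp add: J_def step_eq_1)
  have J0: "J (\<tau> (Suc (Suc n)) t) = 0" using \<tau>_nonpos[OF assms(2)] by (simp add: J_def step_eq_0)
  have t1: "t - T (Suc n) = r (Suc n) * \<tau> (Suc n) t" using r_pos[of "Suc n"] by (simp add: \<tau>_def)
  then have t0: "t - T n = r n + r (Suc n) * \<tau> (Suc n) t" using T_Suc[of n] by simp
  show ?thesis
    unfolding E_def t0 t1 J1 J0 q.simps D_def K_def P_def by (simp add: algebra_simps del: r_Suc \<delta>_Suc)
qed

text \<open>
  The two residuals are absorbed separately.  When one wave is being switched, the other has cutoff \<open>1\<close> and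
  \<open>J\<close> is constant, so \<open>ratio_exponent\<close> turns the quotient of the amplitudes into \<open>W n * \<rho>\<close>; when it is not,
  its residual and its correction both vanish.
\<close>
lemma stage_equation:
  assumes t: "t \<in> {0..1}" "T (Suc n) \<le> t" "t \<le> T (Suc (Suc n))"
  shows "dt u (t, x) + (-1) ^ m * (dx 1 (2 * m) u (t, x) + l t * dx 2 (2 * m) u (t, x))
          + b 1 (t, x) * dx 1 1 u (t, x) + b 2 (t, x) * dx 2 1 u (t, x) + c (t, x) * u (t, x) = 0"
proof -
  let ?\<tau> = "\<tau> (Suc n) t"
  define \<phi>' \<theta>' where "\<phi>' = \<theta> (Suc n) (t, x)" and "\<theta>' = \<theta> n (t, x)"
  define s0 s1 where "s0 = step (3 * ?\<tau>)" and "s1 = step (3 * (1 - ?\<tau>))"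
  define d0 d1 where "d0 = 3 / r (Suc n) * deriv step (3 * ?\<tau>)" and "d1 = 3 / r (Suc n) * deriv step (3 * (1 - ?\<tau>))"
  define U V where "U = \<omega> n * exp (- E n t)" and "V = \<omega> (Suc n) * exp (- E (Suc n) t)"
  have "1 \<le> \<tau> n t" "\<tau> (Suc (Suc n)) t \<le> 0" using \<tau>_ge_1[OF t(2)] \<tau>_nonpos[OF t(3)] by auto
  then have amps: "amp n t = s1 * exp (- E n t)" "amp (Suc n) t = s0 * exp (- E (Suc n) t)"
    "res n t = - d1 * exp (- E n t)" "res (Suc n) t = d0 * exp (- E (Suc n) t)"
    by (simp_all add: amp_def res_def cut_def cut'_def s0_def s1_def d0_def d1_def step_eq_1 deriv_step_eq_0)
  have I2: "t \<le> T k \<or> T (Suc (Suc k)) \<le> t" if "k \<notin> {n, Suc n}" for k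
  proof -
    from that consider "Suc k \<le> n" | "Suc (Suc n) \<le> k" by force
    then show ?thesis by cases (use t T_le[of "Suc (Suc k)" "Suc n"] T_le[of "Suc (Suc n)" k] in auto)
  qed
  have I1: "t \<le> T (Suc k) \<or> T (Suc (Suc k)) \<le> t" if "k \<notin> {n}" for k
  proof -
    from that consider "Suc k \<le> n" | "Suc n \<le> k" by force
    then show ?thesis by cases (use t T_le[of "Suc (Suc k)" "Suc n"] T_le[of "Suc (Suc n)" "Suc k"] in auto)
  qed
  have dir: "dir (Suc n) \<noteq> dir n" by (simp add: dir_def)
  note fs = finite_sums[where I = "{n, Suc n}" and x = x, OF t(1) _ I2, simplified, folded \<phi>'_def \<theta>'_def]
  have u: "u (t, x) = U * s1 * cos \<theta>' + V * s0 * cos \<phi>'"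
    using fs(1) by (simp add: amps U_def V_def mult_ac)
  have main: "dt u (t, x) + (-1) ^ m * (dx 1 (2 * m) u (t, x) + l t * dx 2 (2 * m) u (t, x))
      = - (U * d1 * cos \<theta>') + V * d0 * cos \<phi>'"
    using fs(3) by (simp add: amps U_def V_def mult_ac)
  have dxn: "dx (dir n) 1 u (t, x) = - (z n * (U * s1 * sin \<theta>'))"
    "dx (dir (Suc n)) 1 u (t, x) = - (z (Suc n) * (V * s0 * sin \<phi>'))"
    using fs(2)[of "dir n"] fs(2)[of "dir (Suc n)"] dir by (auto simp: amps U_def V_def mult_ac)
  define con bon where "con = absorb_c (W n) (\<rho>_on n t) (\<sigma>_on n t) \<phi>' \<theta>'" and "bon = absorb_b (W n) (\<rho>_on n t) (\<sigma>_on n t) \<phi>' \<theta>'"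
  define coff boff where "coff = absorb_c (W n) (\<rho>_off n t) (\<sigma>_off n t) \<theta>' \<phi>'" and "boff = absorb_b (W n) (\<rho>_off n t) (\<sigma>_off n t) \<theta>' \<phi>'"
  note cs = coeff_sum[where I = "{n}" and x = x, OF _ I1, simplified, folded \<phi>'_def \<theta>'_def]
  have bn: "b (dir n) (t, x) = W n * bon / z n" "b (dir (Suc n)) (t, x) = W n * boff / z (Suc n)"
    using cs(2)[of "dir n"] cs(2)[of "dir (Suc n)"] dir by (auto simp: bon_def boff_def)
  have "b 1 (t, x) * dx 1 1 u (t, x) + b 2 (t, x) * dx 2 1 u (t, x)
      = b (dir n) (t, x) * dx (dir n) 1 u (t, x) + b (dir (Suc n)) (t, x) * dx (dir (Suc n)) 1 u (t, x)"
    by (simp add: dir_def)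
  also have "\<dots> = - (W n * bon * U * s1 * sin \<theta>') - W n * boff * V * s0 * sin \<phi>'"
    unfolding dxn bn using z_ge_1[of n] z_ge_1[of "Suc n"] by (simp add: mult_ac)
  finally have bsum: "b 1 (t, x) * dx 1 1 u (t, x) + b 2 (t, x) * dx 2 1 u (t, x)
      = - (W n * bon * U * s1 * sin \<theta>') - W n * boff * V * s0 * sin \<phi>'" .
  have c: "c (t, x) = W n * (con + coff)" using cs(1) by (simp add: con_def coff_def)
  have den: "1 + W n * \<rho> * (cos v * cos w) \<noteq> 0" if "\<bar>\<rho>\<bar> \<le> 1" for \<rho> v w :: real
    using absorb_denominator[OF less_imp_le[OF W_bounds(1)] W_bounds(2) that, of n v w] by linarith
  have UV: "U * exp (q n + E n t - (q (Suc n) + E (Suc n) t)) = V"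
    by (simp add: U_def V_def \<omega>_def exp_add[symmetric])
  note ratio = ratio_exponent[OF t(2,3)]
  have on: "W n * (con * (U * s1 * cos \<theta>' + V * s0 * cos \<phi>') - bon * (U * s1 * sin \<theta>')) = - (V * d0 * cos \<phi>')"
  proof (cases "0 < 3 * ?\<tau> \<and> 3 * ?\<tau> < 1")
    case False
    then have "deriv step (3 * ?\<tau>) = 0" by (intro deriv_step_eq_0) auto
    then show ?thesis
      by (simp add: con_def bon_def \<sigma>_on_def rise_rate_def d0_def absorb_0)
  next
    case True
    then have s1: "s1 = 1" by (simp add: s1_def step_eq_1)
    have "J ?\<tau> = 0" using True by (simp add: J_def step_eq_0)
    then have V: "V = U * (W n * exp (- \<kappa>_on n - D n * ?\<tau>))"
      using UV unfolding ratio by (simp add: W_def \<kappa>_on_def exp_add[symmetric])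
    have V1: "V * s0 = U * (W n * \<rho>_on n t)" and V2: "V * d0 = U * (W n * \<sigma>_on n t)"
      unfolding V by (simp_all add: s0_def d0_def \<rho>_on_def \<sigma>_on_def rise_def rise_rate_def mult_ac)
    have "W n * (con * (U * s1 * cos \<theta>' + V * s0 * cos \<phi>') - bon * (U * s1 * sin \<theta>'))
      = U * W n * (con * (cos \<theta>' + W n * \<rho>_on n t * cos \<phi>') - bon * sin \<theta>')"
      unfolding V1 s1 by (simp add: algebra_simps)
    also have "\<dots> = - (V * d0 * cos \<phi>')"
      unfolding con_def bon_def absorb[OF den[OF \<rho>_bounds(1)]] V2 by (simp add: mult_ac)
    finally show ?thesis .
  qed
  have off: "W n * (coff * (U * s1 * cos \<theta>' + V * s0 * cos \<phi>') - boff * (V * s0 * sin \<phi>')) = U * d1 * cos \<theta>'"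
  proof (cases "0 < 3 * (1 - ?\<tau>) \<and> 3 * (1 - ?\<tau>) < 1")
    case False
    then have "deriv step (3 * (1 - ?\<tau>)) = 0" by (intro deriv_step_eq_0) auto
    then show ?thesis
      by (simp add: coff_def boff_def \<sigma>_off_def rise_rate_def d1_def absorb_0)
  next
    case True
    then have s0: "s0 = 1" by (simp add: s0_def step_eq_1)
    have "J ?\<tau> = 1" using True by (simp add: J_def step_eq_1)
    then have "V = U * exp (- (P n / 2) - D n * ?\<tau> + K n)"
      using UV unfolding ratio by simp
    then have "U = V * exp (P n / 2 + D n * ?\<tau> - K n)"
      by (simp add: exp_add[symmetric])
    also have "P n / 2 + D n * ?\<tau> - K n = - (P n / 4) + (- \<kappa>_off n - D n * (1 - ?\<tau>))"
      by (simp add: \<kappa>_off_def algebra_simps)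
    finally have U: "U = V * (W n * exp (- \<kappa>_off n - D n * (1 - ?\<tau>)))"
      unfolding exp_add W_def .
    have U1: "U * s1 = V * (W n * \<rho>_off n t)" and U2: "U * d1 = - (V * (W n * \<sigma>_off n t))"
      by (subst U, simp add: s1_def d1_def \<rho>_off_def \<sigma>_off_def rise_def rise_rate_def mult_ac)+
    have "W n * (coff * (U * s1 * cos \<theta>' + V * s0 * cos \<phi>') - boff * (V * s0 * sin \<phi>'))
      = V * W n * (coff * (cos \<phi>' + W n * \<rho>_off n t * cos \<theta>') - boff * sin \<phi>')"
      unfolding U1 s0 by (simp add: algebra_simps)
    also have "\<dots> = U * d1 * cos \<theta>'"
      unfolding coff_def boff_def absorb[OF den[OF \<rho>_bounds(2)]] U2 by (simp add: mult_ac)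
    finally show ?thesis .
  qed
  show ?thesis
    using on off main bsum unfolding c u by (simp add: algebra_simps)
qed

lemma equation:
  assumes t: "t \<in> {0..1}"
  shows "dt u (t, x) + (-1) ^ m * (dx 1 (2 * m) u (t, x) + l t * dx 2 (2 * m) u (t, x))
          + b 1 (t, x) * dx 1 1 u (t, x) + b 2 (t, x) * dx 2 1 u (t, x) + c (t, x) * u (t, x) = 0"
proof -
  consider "t \<le> T 1" | n where "T (Suc n) \<le> t" "t \<le> T (Suc (Suc n))" | "t = 1"
  proof (cases "t = 1")
    case False
    then have "t < 1" using t by simp
    then have "\<forall>\<^sub>F n in sequentially. t < T n" using T_lim by (simp add: order_tendstoD)
    then have "\<exists>n. t < T n" by (meson eventually_sequentially order_refl)
    define N where "N = (LEAST n. t < T n)"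
    have N: "t < T N" unfolding N_def by (rule LeastI_ex) fact
    show ?thesis
    proof (cases "N \<le> 1")
      case True
      then have "t \<le> T 1" using N T_le[of N 1] by simp
      then show ?thesis using that(1) by blast
    next
      case False
      then obtain n where n: "N = Suc (Suc n)" by (auto simp: not_le less_iff_Suc_add)
      have "\<not> t < T (Suc n)" using not_less_Least[of "Suc n" "\<lambda>n. t < T n"] n by (simp add: N_def)
      then show ?thesis using that(2)[of n] N n by simp
    qed
  qed
  then show ?thesis
  proof cases
    \<comment> \<open>only wave \<open>0\<close> is present, fully switched on, and no coefficient is active\<close>
    case 1
    have "t \<le> T n \<or> T (Suc (Suc n)) \<le> t" if "n \<notin> {0}" for n
      using 1 T_le[of 1 n] that by (auto simp: Suc_le_eq)
    note fs = finite_sums(3)[where I = "{0}" and x = x, OF t _ this, simplified]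
    have "1/3 \<le> \<tau> 0 t"
      using T_0 t r_pos[of 0] by (simp add: \<tau>_def field_simps)
    moreover have "\<tau> (Suc 0) t \<le> 0" using 1 by (intro \<tau>_nonpos) simp
    ultimately have "res 0 t = 0" by (simp add: res_def cut'_def deriv_step_eq_0)
    moreover have "t \<le> T (Suc n) \<or> T (Suc (Suc n)) \<le> t" if "n \<notin> {}" for n
      using 1 T_le[of 1 "Suc n"] by auto
    note coeff_sum[where I = "{}" and x = x, OF _ this, simplified]
    ultimately show ?thesis using fs by simp
  next
    case 2
    then show ?thesis using stage_equation[OF t] by blast
  next
    case 3
    have "t \<le> T n \<or> T (Suc (Suc n)) \<le> t" "t \<le> T (Suc n) \<or> T (Suc (Suc n)) \<le> t" if "n \<notin> {}" for n
      using 3 T_less_1[of "Suc (Suc n)"] by auto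
    then show ?thesis using finite_sums(3)[OF t finite.emptyI, where x = x] coeff_sum[where x = x, OF finite.emptyI, of t]
      by simp
  qed
qed

lemma u_final: "u (1, x) = 0"
  using finite_sums(1)[of 1 "{}", where x = x] T_less_1 by (simp add: less_imp_le)

text \<open>
  At the time \<open>T (n + 1)\<close> of a change of windows wave \<open>n\<close> is alone and fully switched on.
\<close>
lemma u_nonzero: "\<exists>t\<in>{0..1}. \<exists>x. u (t, x) \<noteq> 0"
proof -
  have "\<forall>\<^sub>F n in sequentially. 0 < T n" using T_lim by (simp add: order_tendstoD)
  then obtain n where "\<forall>k\<ge>n. 0 < T k" by (auto simp: eventually_sequentially)
  then have n: "0 < T (Suc n)" by simp
  define t where "t = T (Suc n)"
  have t: "t \<in> {0..1}" using n T_less_1[of "Suc n"] by (simp add: t_def)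
  have "t \<le> T k \<or> T (Suc (Suc k)) \<le> t" if "k \<notin> {n}" for k
  proof -
    from that consider "Suc k \<le> n" | "Suc n \<le> k" by force
    then show ?thesis unfolding t_def by cases (use T_le[of "Suc (Suc k)" "Suc n"] T_le[of "Suc n" k] in auto)
  qed
  from finite_sums(1)[where I = "{n}" and x = 0, OF t _ this]
  have "u (t, 0) = \<omega> n * amp n t" by (simp add: \<theta>_def)
  moreover have "cut n t = 1"
    using \<tau>_ge_1[of n t] \<tau>_nonpos[of t "Suc n"] by (simp add: cut_def step_eq_1 t_def)
  then have "amp n t > 0" by (simp add: amp_def)
  ultimately have "u (t, 0) \<noteq> 0" using \<omega>_pos[of n] by simp
  then show ?thesis using t by blast
qed

end

theorem theorem2:
  fixes \<mu> :: "real \<Rightarrow> real"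
  assumes "\<mu> ` {0..1} \<subseteq> {0..1}"
    and "concave_on {0..1} \<mu>"
    and "strict_mono_on {0..1} \<mu>"
    and "\<mu> 0 = 0"
    and "\<not> osgood \<mu>"
  shows "\<forall>m::nat. m > 0 \<longrightarrow>
    (\<exists>(l :: real \<Rightarrow> real) (b1 :: real \<times> (real^2) \<Rightarrow> real) (b2 :: real \<times> (real^2) \<Rightarrow> real)
       (c :: real \<times> (real^2) \<Rightarrow> real) (u :: real \<times> (real^2) \<Rightarrow> real).
       l \<in> C_mod \<mu> {0..1} \<and> (\<forall>t\<in>{0..1}. 1/2 \<le> l t \<and> l t \<le> 3/2) \<and>
       b1 \<in> Cb_infinity slab \<and> b2 \<in> Cb_infinity slab \<and> c \<in> Cb_infinity slab \<and>
       u \<in> Cb_infinity slab \<and>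
       (\<forall>x. u (1, x) = 0) \<and> (\<exists>t\<in>{0..1}. \<exists>x. u (t, x) \<noteq> 0) \<and>
       (\<forall>t\<in>{0..1}. \<forall>x.
          dt u (t, x) + (-1) ^ m * (dx 1 (2 * m) u (t, x) + l t * dx 2 (2 * m) u (t, x))
          + b1 (t, x) * dx 1 1 u (t, x) + b2 (t, x) * dx 2 1 u (t, x) + c (t, x) * u (t, x) = 0))"
proof (intro allI impI)
  fix m :: nat assume m: "m > 0"
  obtain B where B: "B \<ge> 1" "\<And>x. \<bar>deriv step x\<bar> \<le> B"
      "\<And>x x'. \<bar>deriv step x - deriv step x'\<bar> \<le> B * \<bar>x - x'\<bar>"
    using deriv_step_bound by blast
  interpret modulus \<mu> by standard (fact assms)+
  define y0 where "y0 = min 1 (\<mu> 1 / (24 * B))"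
  interpret cascade \<mu> B y0 m
    by standard (use assms(5) m B pos[of 1] in \<open>auto simp: y0_def\<close>)
  show "\<exists>l b1 b2 c u. l \<in> C_mod \<mu> {0..1} \<and> (\<forall>t\<in>{0..1}. 1/2 \<le> l t \<and> l t \<le> 3/2) \<and>
       b1 \<in> Cb_infinity slab \<and> b2 \<in> Cb_infinity slab \<and> c \<in> Cb_infinity slab \<and>
       u \<in> Cb_infinity slab \<and>
       (\<forall>x. u (1, x) = 0) \<and> (\<exists>t\<in>{0..1}. \<exists>x. u (t, x) \<noteq> 0) \<and>
       (\<forall>t\<in>{0..1}. \<forall>x.
          dt u (t, x) + (-1) ^ m * (dx 1 (2 * m) u (t, x) + l t * dx 2 (2 * m) u (t, x))
          + b1 (t, x) * dx 1 1 u (t, x) + b2 (t, x) * dx 2 1 u (t, x) + c (t, x) * u (t, x) = 0)"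
    using l_C_mod l_bounds b_smooth c_smooth u_smooth u_final u_nonzero equation
    by (intro exI[of _ l] exI[of _ "b 1"] exI[of _ "b 2"] exI[of _ c] exI[of _ u]) blast
qed

end
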